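(* Let $\mathcal{C}_0(\Phi)$ be the set of $0$-dimensional layers of the toric arrangement defined by the irreducible root system $\Phi$, and let $V(\Gamma)=\{0,1,\dots,n\}$ be the vertex set of the affine Dynkin diagram $\Gamma$ of $\Phi$. There is a bijection $p\mapsto \mathcal{O}_p$ from $V(\Gamma)$ to the set of $W$-orbits of $\mathcal{C}_0(\Phi)$ such that, for every $p\in V(\Gamma)$ and every point $t\in\mathcal{O}_p$, the subsystem $\Phi(t)$ is $W$-conjugate to $\Phi_p$ and the stabilizer $W(t)$ of $t$ in $W$ is conjugate in $W$ to $W_p$.
   Context: Let $\mathfrak{g}$ be a simple Lie algebra of rank $n$ over $\mathbb{C}$, $\mathfrak{h}$ a Cartan subalgebra, $\Phi\subset\mathfrak{h}^*$ its (irreducible) root system, $\Phi^\vee\subset\mathfrak{h}$ the coroot system, $W$ the Weyl group. Let $\langle\Phi^\vee\rangle$ be the lattice spanned by the coroots and $T=\mathfrak{h}/\langle\Phi^\vee\rangle$, a complex torus of rank $n$, on which $W$ acts. Each root $\alpha$ takes integer values on $\langle\Phi^\vee\rangle$, hence induces a character $e^\alpha:T\to\mathbb{C}/\mathbb{Z}\simeq\mathbb{C}^*$. Put $H_\alpha=\{t\in T: e^\alpha(t)=1\}$. The toric arrangement is $\{H_\alpha:\alpha\in\Phi^+\}$, and its layers are the connected components of intersections of its elements; $\mathcal{C}_0(\Phi)$ is the set of $0$-dimensional layers. A subsystem of $\Phi$ is a subset $\Theta\subseteq\Phi$ such that $\alpha\in\Theta\Rightarrow-\alpha\in\Theta$,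 and $\alpha,\beta\in\Theta$, $\alpha+\beta\in\Phi\Rightarrow\alpha+\beta\in\Theta$. For $t\in T$, $\Phi(t)=\{\alpha\in\Phi: e^\alpha(t)=1\}$; thus $\mathcal{C}_0(\Phi)$ is the set of $t\in T$ such that $\Phi(t)$ has rank $n$. $W(t)$ denotes the stabilizer of $t$ in $W$. Let $\alpha_1,\dots,\alpha_n$ be simple roots and $\alpha_0$ the lowest root (the opposite of the highest root). The vertices of the affine Dynkin diagram $\Gamma$ correspond to $\alpha_0,\alpha_1,\dots,\alpha_n$ and are identified with the integers $0,\dots,n$. For $p\in V(\Gamma)$, $\Phi_p$ is the subsystem of $\Phi$ generated by $\{\alpha_i\}_{0\le i\le n,\, i\ne p}$, and $W_p$ is its Weyl group, i.e. the subgroup of $W$ generated by the reflections $s_{\alpha_i}$, $0\le i\le n$, $i\neq p$. *)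

theory Defs
  imports "HOL-Analysis.Analysis" "HOL-Algebra.Algebra"
begin

unbundle no m_inv_syntax

section \<open>Root systems\<close>

text \<open>
  The Cartan subalgebra is the space \<open>complex^'n\<close>, of dimension \<open>CARD('n)\<close>.  A linear form on it
  is written as the vector of its coordinates in the dual basis, so that the pairing of a form
  with a vector is the complex bilinear (not sesquilinear) one.
\<close>

definition pairing :: "complex^'n \<Rightarrow> complex^'n \<Rightarrow> complex" where
  "pairing a x = (\<Sum>i\<in>UNIV. a $ i * x $ i)"

definition is_coroot :: "(complex^'n) set \<Rightarrow> complex^'n \<Rightarrow> complex^'n \<Rightarrow> bool" where
  "is_coroot \<Phi> \<alpha> c \<longleftrightarrow> pairing \<alpha> c = 2 \<and> (\<lambda>\<beta>. \<beta> - pairing \<beta> c *s \<alpha>) ` \<Phi> \<subseteq> \<Phi>"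

text \<open>Coroots are unique for finite spanning \<open>\<Phi>\<close>; see \<open>is_coroot_unique\<close> below.\<close>

definition coroot :: "(complex^'n) set \<Rightarrow> complex^'n \<Rightarrow> complex^'n" where
  "coroot \<Phi> \<alpha> = (THE c. is_coroot \<Phi> \<alpha> c)"

text \<open>Reduced crystallographic root systems in the dual of \<open>complex^'n\<close>.\<close>

definition root_system :: "(complex^'n) set \<Rightarrow> bool" where
  "root_system \<Phi> \<longleftrightarrow>
     finite \<Phi> \<and> vec.span \<Phi> = UNIV \<and> 0 \<notin> \<Phi> \<and>
     (\<forall>\<alpha>\<in>\<Phi>. \<exists>c. is_coroot \<Phi> \<alpha> c) \<and>
     (\<forall>\<alpha>\<in>\<Phi>. \<forall>\<beta>\<in>\<Phi>. pairing \<beta> (coroot \<Phi> \<alpha>) \<in> \<int>) \<and>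
     (\<forall>\<alpha>\<in>\<Phi>. \<forall>k. k *s \<alpha> \<in> \<Phi> \<longrightarrow> k = 1 \<or> k = -1)"

definition irreducible_system :: "(complex^'n) set \<Rightarrow> bool" where
  "irreducible_system \<Phi> \<longleftrightarrow>
     \<Phi> \<noteq> {} \<and>
     \<not> (\<exists>\<Phi>1 \<Phi>2. \<Phi>1 \<noteq> {} \<and> \<Phi>2 \<noteq> {} \<and> \<Phi>1 \<union> \<Phi>2 = \<Phi> \<and> \<Phi>1 \<inter> \<Phi>2 = {} \<and>
          (\<forall>\<alpha>\<in>\<Phi>1. \<forall>\<beta>\<in>\<Phi>2. pairing \<alpha> (coroot \<Phi> \<beta>) = 0))"

definition subsystem :: "(complex^'n) set \<Rightarrow> (complex^'n) set \<Rightarrow> bool" where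
  "subsystem \<Phi> \<Theta> \<longleftrightarrow>
     \<Theta> \<subseteq> \<Phi> \<and> (\<forall>\<alpha>\<in>\<Theta>. - \<alpha> \<in> \<Theta>) \<and> (\<forall>\<alpha>\<in>\<Theta>. \<forall>\<beta>\<in>\<Theta>. \<alpha> + \<beta> \<in> \<Phi> \<longrightarrow> \<alpha> + \<beta> \<in> \<Theta>)"

text \<open>
  In the following, \<open>\<alpha> 1, \<dots>, \<alpha> n\<close> are the simple roots; the value \<open>\<alpha> 0\<close> is not used
  until the affine vertex enters.
\<close>

definition nonneg_comb :: "(nat \<Rightarrow> complex^'n) \<Rightarrow> complex^'n \<Rightarrow> bool" where
  "nonneg_comb \<alpha> x \<longleftrightarrow> (\<exists>k :: nat \<Rightarrow> nat. x = (\<Sum>i\<in>{1..CARD('n)}. of_nat (k i) *s \<alpha> i))"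

definition simple_roots :: "(complex^'n) set \<Rightarrow> (nat \<Rightarrow> complex^'n) \<Rightarrow> bool" where
  "simple_roots \<Phi> \<alpha> \<longleftrightarrow>
     inj_on \<alpha> {1..CARD('n)} \<and> \<alpha> ` {1..CARD('n)} \<subseteq> \<Phi> \<and>
     vec.independent (\<alpha> ` {1..CARD('n)}) \<and>
     (\<forall>\<beta>\<in>\<Phi>. nonneg_comb \<alpha> \<beta> \<or> nonneg_comb \<alpha> (- \<beta>))"

definition positive_roots :: "(complex^'n) set \<Rightarrow> (nat \<Rightarrow> complex^'n) \<Rightarrow> (complex^'n) set" where
  "positive_roots \<Phi> \<alpha> = {\<beta> \<in> \<Phi>. nonneg_comb \<alpha> \<beta>}"

definition is_highest_root :: "(complex^'n) set \<Rightarrow> (nat \<Rightarrow> complex^'n) \<Rightarrow> complex^'n \<Rightarrow> bool" where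
  "is_highest_root \<Phi> \<alpha> \<theta> \<longleftrightarrow> \<theta> \<in> \<Phi> \<and> (\<forall>\<beta>\<in>\<Phi>. nonneg_comb \<alpha> (\<theta> - \<beta>))"


section \<open>The Weyl group\<close>

text \<open>
  The Weyl group is taken as a group of transformations of the Cartan subalgebra; its action on
  linear forms is the contragredient one.
\<close>

definition reflection :: "(complex^'n) set \<Rightarrow> complex^'n \<Rightarrow> complex^'n \<Rightarrow> complex^'n" where
  "reflection \<Phi> \<alpha> = (\<lambda>x. x - pairing \<alpha> x *s coroot \<Phi> \<alpha>)"

definition weyl_group :: "(complex^'n) set \<Rightarrow> (complex^'n \<Rightarrow> complex^'n) monoid" where
  "weyl_group \<Phi> = subgroup_generated (BijGroup UNIV) (reflection \<Phi> ` \<Phi>)"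

text \<open>The coordinates of the linear form \<open>\<beta> \<circ> w\<inverse>\<close>.\<close>

definition dual_act :: "(complex^'n \<Rightarrow> complex^'n) \<Rightarrow> complex^'n \<Rightarrow> complex^'n" where
  "dual_act w \<beta> = (\<chi> i. pairing \<beta> (inv w (axis i 1)))"


section \<open>The toric arrangement\<close>

definition coroot_lattice :: "(complex^'n) set \<Rightarrow> (complex^'n) set" where
  "coroot_lattice \<Phi> = {\<Sum>\<alpha>\<in>\<Phi>. of_int (k \<alpha>) *s coroot \<Phi> \<alpha> | k :: complex^'n \<Rightarrow> int. True}"

definition lattice_rel :: "(complex^'n) set \<Rightarrow> ((complex^'n) \<times> (complex^'n)) set" where
  "lattice_rel \<Phi> = {(x, y). x - y \<in> coroot_lattice \<Phi>}"

definition torus :: "(complex^'n) set \<Rightarrow> (complex^'n) set set" where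
  "torus \<Phi> = UNIV // lattice_rel \<Phi>"

definition torus_proj :: "(complex^'n) set \<Rightarrow> complex^'n \<Rightarrow> (complex^'n) set" where
  "torus_proj \<Phi> x = lattice_rel \<Phi> `` {x}"

text \<open>The quotient topology; see \<open>quotient_map_torus_proj\<close> below.\<close>

definition torus_topology :: "(complex^'n) set \<Rightarrow> (complex^'n) set topology" where
  "torus_topology \<Phi> = topology (\<lambda>U. U \<subseteq> torus \<Phi> \<and> open (\<Union>U))"

text \<open>The action of the Weyl group on the torus; points of the torus are cosets.\<close>

definition torus_act :: "(complex^'n \<Rightarrow> complex^'n) \<Rightarrow> (complex^'n) set \<Rightarrow> (complex^'n) set" where
  "torus_act w t = w ` t"

text \<open>The exponential is constant on every coset of the coroot lattice, so the image is a singleton.\<close>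

definition character :: "complex^'n \<Rightarrow> (complex^'n) set \<Rightarrow> complex" where
  "character \<alpha> t = the_elem ((\<lambda>x. exp (2 * of_real pi * \<i> * pairing \<alpha> x)) ` t)"

definition hypersurface :: "(complex^'n) set \<Rightarrow> complex^'n \<Rightarrow> (complex^'n) set set" where
  "hypersurface \<Phi> \<alpha> = {t \<in> torus \<Phi>. character \<alpha> t = 1}"

definition toric_arrangement ::
    "(complex^'n) set \<Rightarrow> (nat \<Rightarrow> complex^'n) \<Rightarrow> (complex^'n) set set set" where
  "toric_arrangement \<Phi> \<alpha> = hypersurface \<Phi> ` positive_roots \<Phi> \<alpha>"

definition layers :: "(complex^'n) set \<Rightarrow> (nat \<Rightarrow> complex^'n) \<Rightarrow> (complex^'n) set set set" where
  "layers \<Phi> \<alpha> =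
     (\<Union>\<A>\<in>Pow (toric_arrangement \<Phi> \<alpha>).
        connected_components_of (subtopology (torus_topology \<Phi>) (\<Inter>\<A>)))"

text \<open>
  A layer is a translate of a subtorus, i.e. the image of an affine subspace of the Cartan
  subalgebra.  The direction of this affine subspace is determined by the layer, and its
  complex dimension is the dimension of the layer.
\<close>

definition layers_of_dim ::
    "nat \<Rightarrow> (complex^'n) set \<Rightarrow> (nat \<Rightarrow> complex^'n) \<Rightarrow> (complex^'n) set set set" where
  "layers_of_dim d \<Phi> \<alpha> =
     {L \<in> layers \<Phi> \<alpha>. \<exists>x U. vec.subspace U \<and> vec.dim U = d \<and> L = torus_proj \<Phi> ` ((+) x ` U)}"

text \<open>A layer of dimension 0 consists of one point, and is identified with this point.\<close>

definition zero_dim_layers ::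
    "(complex^'n) set \<Rightarrow> (nat \<Rightarrow> complex^'n) \<Rightarrow> (complex^'n) set set" where
  "zero_dim_layers \<Phi> \<alpha> = \<Union>(layers_of_dim 0 \<Phi> \<alpha>)"

definition point_system :: "(complex^'n) set \<Rightarrow> (complex^'n) set \<Rightarrow> (complex^'n) set" where
  "point_system \<Phi> t = {\<alpha> \<in> \<Phi>. character \<alpha> t = 1}"


section \<open>The vertices of the affine Dynkin diagram\<close>

text \<open>Here \<open>\<alpha> 0\<close> is the lowest root and \<open>p\<close> ranges over \<open>{0..CARD('n)}\<close>.\<close>

definition vertex_system ::
    "(complex^'n) set \<Rightarrow> (nat \<Rightarrow> complex^'n) \<Rightarrow> nat \<Rightarrow> (complex^'n) set" where
  "vertex_system \<Phi> \<alpha> p = subsystem \<Phi> hull (\<alpha> ` ({0..CARD('n)} - {p}))"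

definition vertex_group ::
    "(complex^'n) set \<Rightarrow> (nat \<Rightarrow> complex^'n) \<Rightarrow> nat \<Rightarrow> (complex^'n \<Rightarrow> complex^'n) set" where
  "vertex_group \<Phi> \<alpha> p =
     generate (weyl_group \<Phi>) (reflection \<Phi> ` \<alpha> ` ({0..CARD('n)} - {p}))"


section \<open>Well-definedness\<close>

lemma pairing_add_left: "pairing (a + b) x = pairing a x + pairing b x"
  by (simp add: pairing_def algebra_simps sum.distrib)

lemma pairing_scale_left: "pairing (k *s a) x = k * pairing a x"
  by (simp add: pairing_def sum_distrib_left mult.assoc)

lemma pairing_diff_left: "pairing (a - b) x = pairing a x - pairing b x"
  by (simp add: pairing_def algebra_simps sum_subtractf)

lemma pairing_diff_right: "pairing a (x - y) = pairing a x - pairing a y"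
  by (simp add: pairing_def algebra_simps sum_subtractf)

lemma is_coroot_unique:
  assumes "finite \<Phi>" "vec.span \<Phi> = UNIV" "is_coroot \<Phi> \<alpha> c" "is_coroot \<Phi> \<alpha> d"
  shows "c = d"
proof -
  have \<alpha>: "pairing \<alpha> c = 2" "pairing \<alpha> d = 2"
    and \<Phi>: "\<And>\<beta>. \<beta> \<in> \<Phi> \<Longrightarrow> \<beta> - pairing \<beta> c *s \<alpha> \<in> \<Phi>" "\<And>\<beta>. \<beta> \<in> \<Phi> \<Longrightarrow> \<beta> - pairing \<beta> d *s \<alpha> \<in> \<Phi>"
    using assms(3,4) by (auto simp: is_coroot_def)
  have zero: "pairing \<beta> (d - c) = 0" if \<beta>: "\<beta> \<in> \<Phi>" for \<beta>
  proof (rule ccontr)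
    define m where "m = pairing \<beta> (d - c)"
    assume "pairing \<beta> (d - c) \<noteq> 0"
    then have m: "m \<noteq> 0" by (simp add: m_def)
    have in\<Phi>: "\<beta> + (of_nat k * m) *s \<alpha> \<in> \<Phi>" for k
    proof (induction k)
      case 0
      then show ?case using \<beta> by simp
    next
      case (Suc k)
      let ?\<gamma> = "\<beta> + (of_nat k * m) *s \<alpha>"
      let ?\<delta> = "?\<gamma> - pairing ?\<gamma> d *s \<alpha>"
      have "?\<delta> - pairing ?\<delta> c *s \<alpha> \<in> \<Phi>" using \<Phi> Suc by blast
      moreover have "?\<delta> - pairing ?\<delta> c *s \<alpha> = \<beta> + (of_nat (Suc k) * m) *s \<alpha>"
        by (simp add: pairing_add_left pairing_scale_left pairing_diff_left \<alpha> m_def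
              pairing_diff_right vec_eq_iff algebra_simps)
      ultimately show ?case by simp
    qed
    have "\<alpha> \<noteq> 0" using \<alpha> by (auto simp: pairing_def)
    then have "inj (\<lambda>k::nat. \<beta> + (of_nat k * m) *s \<alpha>)"
      using m by (auto simp: inj_on_def)
    moreover have "finite (range (\<lambda>k::nat. \<beta> + (of_nat k * m) *s \<alpha>))"
      by (rule finite_subset[OF _ assms(1)]) (use in\<Phi> in auto)
    ultimately show False using finite_imageD by fastforce
  qed
  have "pairing \<beta> (d - c) = 0" for \<beta>
  proof -
    have "\<beta> \<in> vec.span \<Phi>" using assms(2) by simp
    then show ?thesis
    proof (induction rule: vec.span_induct_alt)
      case base
      then show ?case by (simp add: pairing_def)
    next
      case (step k x y)
      then show ?case by (simp add: pairing_add_left pairing_scale_left zero)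
    qed
  qed
  from this[of "axis _ 1"] have "(d - c) $ i = 0" for i
    by (simp add: pairing_def axis_def if_distrib[where f = "\<lambda>u. u * _"] cong: if_cong)
  then show ?thesis by (simp add: vec_eq_iff)
qed

lemma equiv_lattice_rel: "equiv UNIV (lattice_rel \<Phi>)"
proof (rule equivI)
  show "refl (lattice_rel \<Phi>)"
    by (auto simp: refl_on_def lattice_rel_def coroot_lattice_def intro!: exI[of _ "\<lambda>_. 0"])
  show "sym (lattice_rel \<Phi>)"
  proof (rule symI)
    fix x y assume "(x, y) \<in> lattice_rel \<Phi>"
    then obtain k :: "_ \<Rightarrow> int" where "x - y = (\<Sum>\<alpha>\<in>\<Phi>. of_int (k \<alpha>) *s coroot \<Phi> \<alpha>)"
      by (auto simp: lattice_rel_def coroot_lattice_def)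
    then have "y - x = (\<Sum>\<alpha>\<in>\<Phi>. of_int (- k \<alpha>) *s coroot \<Phi> \<alpha>)"
      by (simp add: sum_negf minus_diff_eq[of x y, symmetric] del: minus_diff_eq)
    then show "(y, x) \<in> lattice_rel \<Phi>"
      by (auto simp: lattice_rel_def coroot_lattice_def intro!: exI[of _ "\<lambda>\<alpha>. - k \<alpha>"])
  qed
  show "trans (lattice_rel \<Phi>)"
  proof (rule transI)
    fix x y z assume "(x, y) \<in> lattice_rel \<Phi>" "(y, z) \<in> lattice_rel \<Phi>"
    then obtain k l :: "_ \<Rightarrow> int" where
      "x - y = (\<Sum>\<alpha>\<in>\<Phi>. of_int (k \<alpha>) *s coroot \<Phi> \<alpha>)"
      "y - z = (\<Sum>\<alpha>\<in>\<Phi>. of_int (l \<alpha>) *s coroot \<Phi> \<alpha>)"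
      by (auto simp: lattice_rel_def coroot_lattice_def)
    then have "(x - y) + (y - z) = (\<Sum>\<alpha>\<in>\<Phi>. of_int (k \<alpha> + l \<alpha>) *s coroot \<Phi> \<alpha>)"
      by (simp add: sum.distrib vec.scale_left_distrib)
    then have "x - z = (\<Sum>\<alpha>\<in>\<Phi>. of_int (k \<alpha> + l \<alpha>) *s coroot \<Phi> \<alpha>)" by simp
    then show "(x, z) \<in> lattice_rel \<Phi>"
      unfolding lattice_rel_def coroot_lattice_def mem_Collect_eq case_prod_conv
      by (intro exI[of _ "\<lambda>\<alpha>. k \<alpha> + l \<alpha>"]) simp
  qed
qed simp_all

lemma Union_torus_subset:
  assumes "U \<subseteq> torus \<Phi>"
  shows "\<Union>U = {x. torus_proj \<Phi> x \<in> U}"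
proof -
  have "x \<in> t \<longleftrightarrow> torus_proj \<Phi> x = t" if "t \<in> U" for x t
    using that assms equiv_lattice_rel[of \<Phi>]
    unfolding torus_def torus_proj_def
    by (smt (verit, best) Image_singleton_iff UNIV_I equiv_class_eq_iff equiv_class_self quotientE
        subsetD)
  then show ?thesis by auto
qed

lemma openin_torus_topology:
  "openin (torus_topology \<Phi>) U \<longleftrightarrow> U \<subseteq> torus \<Phi> \<and> open (\<Union>U)"
proof -
  have "istopology (\<lambda>U. U \<subseteq> torus \<Phi> \<and> open (\<Union>U))"
    unfolding istopology_def
  proof (intro conjI allI impI)
    fix S T assume *: "S \<subseteq> torus \<Phi> \<and> open (\<Union>S)" "T \<subseteq> torus \<Phi> \<and> open (\<Union>T)"
    then have "\<Union>(S \<inter> T) = \<Union>S \<inter> \<Union>T"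
      by (subst (1 2 3) Union_torus_subset) auto
    with * show "open (\<Union>(S \<inter> T))" by (simp add: open_Int)
    from * show "S \<inter> T \<subseteq> torus \<Phi>" by blast
  next
    fix \<K> assume *: "\<forall>K\<in>\<K>. K \<subseteq> torus \<Phi> \<and> open (\<Union>K)"
    have "\<Union>(\<Union>\<K>) = (\<Union>K\<in>\<K>. \<Union>K)" by blast
    with * show "open (\<Union>(\<Union>\<K>))" by auto
    from * show "\<Union>\<K> \<subseteq> torus \<Phi>" by blast
  qed
  then show ?thesis by (simp add: torus_topology_def)
qed

lemma quotient_map_torus_proj: "quotient_map euclidean (torus_topology \<Phi>) (torus_proj \<Phi>)"
proof -
  have ran: "range (torus_proj \<Phi>) = torus \<Phi>"
    by (auto simp: torus_proj_def torus_def quotient_def)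
  have "\<Union>(torus \<Phi>) = UNIV"
    using ran by (subst Union_torus_subset) auto
  then have "topspace (torus_topology \<Phi>) = torus \<Phi>"
    by (auto simp: topspace_def openin_torus_topology)
  then show ?thesis
    by (auto simp: quotient_map_def ran openin_torus_topology Union_torus_subset)
qed

end

theory Submission
  imports Defs "HOL-Library.Complex_Order"
begin

text \<open>
  The orbits and stabilizers of the Weyl group \<open>W\<close> on the torus \<open>T\<close>, the quotient of the Cartan
  subalgebra by the coroot lattice, come from those of the affine Weyl group, the semidirect product
  of \<open>W\<close> with the lattice, on the Cartan subalgebra.  A point \<open>t\<close> of the torus is a zero-dimensional
  layer iff \<open>\<Phi>(t)\<close> spans (\<open>zero_dim_layers_eq\<close>); all roots then take real values at its
  representatives (\<open>spanning_point_is_real\<close>).  On the real points the affine Weyl group has the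
  alcove as a strict fundamental domain, a simplex bounded by the hyperplanes of the simple affine
  roots \<open>\<alpha> 1, \<dots>, \<alpha> n\<close> and \<open>\<alpha> 0 + 1\<close>.  A point of the alcove represents a zero-dimensional
  layer iff it is one of the \<open>n + 1\<close> vertices of this simplex, and the vertex \<open>p\<close> is the one
  opposite to the wall \<open>p\<close>.  This gives the bijection.

  The fundamental domain is studied through words in the simple affine reflections.  Every affine
  root \<open>\<beta> + k\<close> is an integral combination of the simple affine roots with coefficients of one sign,
  and a simple affine reflection permutes the positive affine roots other than its own
  (\<open>pos_reflection\<close>).  Three consequences are drawn from this.  Every real point can be moved into
  the alcove, because a suitable reflection lowers the number of hyperplanes that separate it from
  the alcove (\<open>ex_word_into_alcove\<close>).  A word that maps a point of the alcove into the alcove fixes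
  it and equals a word in the reflections fixing the point, by the exchange argument
  (\<open>deletion\<close>, \<open>alcove_stabilizer\<close>).  Every affine reflection is a word, so that the words give the
  whole affine Weyl group (\<open>affine_reflection_is_word\<close>, \<open>affine_weyl_element_is_word\<close>).

  At the vertex \<open>p\<close>, the stabilizer in the affine Weyl group is therefore generated by the
  reflections in the walls other than \<open>p\<close>, and its linear parts form \<open>W\<^sub>p\<close>
  (\<open>stabilizer_vertex\<close>).  The roots integral at the vertex are the linear parts of the affine
  roots that vanish there; these are combinations of the simple affine roots other than \<open>p\<close> and can
  be built from them one at a time, which gives the subsystem \<open>\<Phi>\<^sub>p\<close> (\<open>vertex_system_eq\<close>).  At the
  other points of the orbit, both are conjugated by the element of \<open>W\<close> that moves the vertex there.
\<close>


section \<open>The bilinear pairing\<close>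

lemma pairing_zero_left [simp]: "pairing 0 x = 0"
  by (simp add: pairing_def)

lemma pairing_zero_right [simp]: "pairing a 0 = 0"
  by (simp add: pairing_def)

lemma pairing_minus_left [simp]: "pairing (- a) x = - pairing a x"
  by (simp add: pairing_def sum_negf)

lemma pairing_minus_right [simp]: "pairing a (- x) = - pairing a x"
  by (simp add: pairing_def sum_negf)

lemma pairing_add_right: "pairing a (x + y) = pairing a x + pairing a y"
  by (simp add: pairing_def algebra_simps sum.distrib)

lemma pairing_scale_right: "pairing a (k *s x) = k * pairing a x"
  by (simp add: pairing_def sum_distrib_left algebra_simps)

lemma pairing_sum_left: "pairing (\<Sum>i\<in>I. f i) x = (\<Sum>i\<in>I. pairing (f i) x)"
  by (induction I rule: infinite_finite_induct) (simp_all add: pairing_add_left)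

lemma pairing_sum_right: "pairing a (\<Sum>i\<in>I. f i) = (\<Sum>i\<in>I. pairing a (f i))"
  by (induction I rule: infinite_finite_induct) (simp_all add: pairing_add_right)

lemmas pairing_simps = pairing_add_left pairing_diff_left pairing_scale_left
  pairing_add_right pairing_diff_right pairing_scale_right

lemma pairing_axis_left: "pairing (axis i 1) x = x $ i"
  by (simp add: pairing_def axis_def if_distrib[where f = "\<lambda>u. u * _"] cong: if_cong)

lemma pairing_axis_right: "pairing a (axis i 1) = a $ i"
  by (simp add: pairing_def axis_def if_distrib cong: if_cong)

lemma pairing_eq_zero_on_span:
  assumes "a \<in> vec.span S" "\<And>s. s \<in> S \<Longrightarrow> pairing s x = 0"
  shows "pairing a x = 0"
  using assms(1) by (induction rule: vec.span_induct_alt) (simp_all add: pairing_simps assms(2))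

lemma eq_if_pairing_eq_on_spanning:
  assumes "vec.span S = UNIV" "\<And>s. s \<in> S \<Longrightarrow> pairing s x = pairing s y"
  shows "x = y"
proof -
  have "pairing (axis i 1) (x - y) = 0" for i
    by (rule pairing_eq_zero_on_span[of _ S]) (use assms in \<open>simp_all add: pairing_diff_right\<close>)
  then show ?thesis by (simp add: pairing_axis_left vec_eq_iff)
qed

lemma form_eqI:
  assumes "\<And>x. pairing a x = pairing b x"
  shows "a = b"
  using assms[of "axis _ 1"] by (simp add: pairing_axis_right vec_eq_iff)

lemma continuous_on_pairing [continuous_intros]:
  "continuous_on S f \<Longrightarrow> continuous_on S (\<lambda>x. pairing a (f x))"
  unfolding pairing_def by (intro continuous_intros)

text \<open>
  Extend the prescribed values to a linear form on the space of forms; such a form is evaluation at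
  the vector of its values on the coordinate forms.
\<close>

lemma ex_vector_with_prescribed_pairings:
  assumes "vec.independent (S :: (complex^'n) set)"
  shows "\<exists>u. \<forall>s\<in>S. pairing s u = g s"
proof -
  obtain f :: "complex^'n \<Rightarrow> complex^'n" where f: "Vector_Spaces.linear (*s) (*s) f"
    and fS: "\<forall>s\<in>S. f s = (\<chi> i. g s)"
    using vec.linear_independent_extend[OF assms, of "\<lambda>s. \<chi> i. g s"] by blast
  \<comment> \<open>All coordinates of \<open>f\<close> are the extended form; pick any one of them.\<close>
  define k :: 'n where "k = undefined"
  define u where "u = (\<chi> i. f (axis i 1) $ k)"
  have "f a $ k = pairing a u" for a
  proof -
    have "f a = f (\<Sum>i\<in>UNIV. a $ i *s axis i 1)"
      by (simp add: basis_expansion)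
    also have "\<dots> = (\<Sum>i\<in>UNIV. a $ i *s f (axis i 1))"
      by (simp add: vec.linear_sum[OF f] vec.linear_scale[OF f])
    finally show ?thesis
      by (simp add: pairing_def u_def)
  qed
  then have "\<forall>s\<in>S. pairing s u = g s"
    using fS by (metis vec_lambda_beta)
  then show ?thesis by blast
qed

text \<open>
  A basis of the span of \<open>S\<close> stays independent when a form outside the span is added; prescribe the
  value \<open>1\<close> there and \<open>0\<close> on the basis.
\<close>

lemma ex_nonzero_vector_annihilated:
  assumes "vec.span S \<noteq> (UNIV :: (complex^'n) set)"
  shows "\<exists>u. u \<noteq> 0 \<and> (\<forall>s\<in>S. pairing s u = 0)"
proof -
  obtain B where B: "B \<subseteq> S" "vec.independent B" "S \<subseteq> vec.span B"
    using vec.maximal_independent_subset by blast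
  have "vec.span B = vec.span S"
    using B by (meson subset_antisym vec.span_minimal vec.span_mono vec.subspace_span)
  with assms obtain b where b: "b \<notin> vec.span B" by blast
  then have "vec.independent (insert b B)"
    by (rule vec.independent_insertI[OF _ B(2)])
  from ex_vector_with_prescribed_pairings[OF this, of "\<lambda>s. if s = b then 1 else 0"]
  obtain u where u: "\<forall>s\<in>insert b B. pairing s u = (if s = b then 1 else 0)" ..
  have "b \<notin> B" using b vec.span_base by blast
  then have "pairing s u = 0" if "s \<in> B" for s
    using u that by auto
  then have "pairing s u = 0" if "s \<in> S" for s
    using pairing_eq_zero_on_span[of s B u] B(3) that by auto
  moreover have "u \<noteq> 0" using u by auto
  ultimately show ?thesis by blast
qed


section \<open>Root systems\<close>

definition root_reflection :: "(complex^'n) set \<Rightarrow> complex^'n \<Rightarrow> complex^'n \<Rightarrow> complex^'n" where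
  "root_reflection \<Phi> \<alpha> \<beta> = \<beta> - pairing \<beta> (coroot \<Phi> \<alpha>) *s \<alpha>"

definition cartan_int :: "(complex^'n) set \<Rightarrow> complex^'n \<Rightarrow> complex^'n \<Rightarrow> int" where
  "cartan_int \<Phi> \<beta> \<alpha> = \<lfloor>Re (pairing \<beta> (coroot \<Phi> \<alpha>))\<rfloor>"

text \<open>The value \<open>\<Sum>\<gamma>. \<gamma>(\<alpha>\<^sup>\<vee>) \<gamma>(\<beta>\<^sup>\<vee>)\<close> of the canonical invariant form on the coroots.\<close>

definition coroot_form :: "(complex^'n) set \<Rightarrow> complex^'n \<Rightarrow> complex^'n \<Rightarrow> int" where
  "coroot_form \<Phi> \<alpha> \<beta> = (\<Sum>\<gamma>\<in>\<Phi>. cartan_int \<Phi> \<gamma> \<alpha> * cartan_int \<Phi> \<gamma> \<beta>)"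

locale root_sys =
  fixes \<Phi> :: "(complex^'n) set"
  assumes root_system: "root_system \<Phi>"
begin

lemma finite_roots: "finite \<Phi>" and span_roots: "vec.span \<Phi> = UNIV" and zero_not_root: "0 \<notin> \<Phi>"
  using root_system by (auto simp: root_system_def)

lemma reduced: "\<alpha> \<in> \<Phi> \<Longrightarrow> k *s \<alpha> \<in> \<Phi> \<Longrightarrow> k = 1 \<or> k = -1"
  using root_system unfolding root_system_def by blast

lemma coroot_eqI: "is_coroot \<Phi> \<alpha> c \<Longrightarrow> coroot \<Phi> \<alpha> = c"
  unfolding coroot_def using is_coroot_unique[OF finite_roots span_roots] by blast

lemma is_coroot_coroot: "\<alpha> \<in> \<Phi> \<Longrightarrow> is_coroot \<Phi> \<alpha> (coroot \<Phi> \<alpha>)"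
  using root_system coroot_eqI unfolding root_system_def by metis

lemma pairing_coroot_self [simp]: "\<alpha> \<in> \<Phi> \<Longrightarrow> pairing \<alpha> (coroot \<Phi> \<alpha>) = 2"
  using is_coroot_coroot by (simp add: is_coroot_def)

lemma root_reflection_in_roots: "\<alpha> \<in> \<Phi> \<Longrightarrow> \<beta> \<in> \<Phi> \<Longrightarrow> root_reflection \<Phi> \<alpha> \<beta> \<in> \<Phi>"
  using is_coroot_coroot by (auto simp: is_coroot_def root_reflection_def)

lemma cartan_int: "\<beta> \<in> \<Phi> \<Longrightarrow> \<alpha> \<in> \<Phi> \<Longrightarrow> pairing \<beta> (coroot \<Phi> \<alpha>) = of_int (cartan_int \<Phi> \<beta> \<alpha>)"
  using root_system unfolding root_system_def cartan_int_def by (metis Ints_cases Re_complex_of_real floor_of_int of_real_of_int_eq)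

lemma cartan_int_self [simp]: "\<alpha> \<in> \<Phi> \<Longrightarrow> cartan_int \<Phi> \<alpha> \<alpha> = 2"
  by (simp add: cartan_int_def)

lemma pairing_root_reflection:
  "pairing (root_reflection \<Phi> \<alpha> \<beta>) x = pairing \<beta> (reflection \<Phi> \<alpha> x)"
  by (simp add: root_reflection_def reflection_def pairing_simps)

lemma reflection_reflection [simp]: "\<alpha> \<in> \<Phi> \<Longrightarrow> reflection \<Phi> \<alpha> (reflection \<Phi> \<alpha> x) = x"
  by (simp add: reflection_def pairing_simps vec_eq_iff algebra_simps)

lemma root_reflection_root_reflection [simp]:
  "\<alpha> \<in> \<Phi> \<Longrightarrow> root_reflection \<Phi> \<alpha> (root_reflection \<Phi> \<alpha> \<beta>) = \<beta>"
  by (rule form_eqI) (simp add: pairing_root_reflection)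

lemma root_reflection_self: "\<alpha> \<in> \<Phi> \<Longrightarrow> root_reflection \<Phi> \<alpha> \<alpha> = - \<alpha>"
  by (simp add: root_reflection_def vec_eq_iff)

lemma minus_root: "\<alpha> \<in> \<Phi> \<Longrightarrow> - \<alpha> \<in> \<Phi>"
  using root_reflection_in_roots root_reflection_self by metis

lemma bij_betw_root_reflection: "\<alpha> \<in> \<Phi> \<Longrightarrow> bij_betw (root_reflection \<Phi> \<alpha>) \<Phi> \<Phi>"
  by (rule bij_betwI[where g = "root_reflection \<Phi> \<alpha>"]) (auto simp: root_reflection_in_roots)

text \<open>
  Coroots are unique, so it suffices that the reflected coroot defines the reflection conjugate to
  that of \<open>\<beta>\<close>.
\<close>

lemma coroot_root_reflection:
  assumes "\<alpha> \<in> \<Phi>" "\<beta> \<in> \<Phi>"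
  shows "coroot \<Phi> (root_reflection \<Phi> \<alpha> \<beta>) = reflection \<Phi> \<alpha> (coroot \<Phi> \<beta>)"
proof (rule coroot_eqI)
  have "\<gamma> - pairing \<gamma> (reflection \<Phi> \<alpha> (coroot \<Phi> \<beta>)) *s root_reflection \<Phi> \<alpha> \<beta>
      = root_reflection \<Phi> \<alpha> (root_reflection \<Phi> \<beta> (root_reflection \<Phi> \<alpha> \<gamma>))" for \<gamma>
    by (rule form_eqI)
      (simp add: pairing_simps pairing_root_reflection, simp add: reflection_def pairing_simps assms algebra_simps)
  then show "is_coroot \<Phi> (root_reflection \<Phi> \<alpha> \<beta>) (reflection \<Phi> \<alpha> (coroot \<Phi> \<beta>))"
    using assms by (auto simp: is_coroot_def pairing_root_reflection root_reflection_in_roots)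
qed

lemma coroot_minus: "\<alpha> \<in> \<Phi> \<Longrightarrow> coroot \<Phi> (- \<alpha>) = - coroot \<Phi> \<alpha>"
  using coroot_root_reflection[of \<alpha> \<alpha>]
  by (simp add: root_reflection_self reflection_def vec_eq_iff)

text \<open>
  The form \<open>\<Sum>\<gamma>. \<gamma>(x) \<gamma>(y)\<close> is invariant, since a reflection permutes the roots; compare its value on
  \<open>x\<close> and the coroot, which is reflected to its negative.
\<close>

lemma invariant_form_coroot:
  assumes "\<alpha> \<in> \<Phi>"
  shows "2 * (\<Sum>\<gamma>\<in>\<Phi>. pairing \<gamma> x * pairing \<gamma> (coroot \<Phi> \<alpha>))
    = pairing \<alpha> x * (\<Sum>\<gamma>\<in>\<Phi>. pairing \<gamma> (coroot \<Phi> \<alpha>) * pairing \<gamma> (coroot \<Phi> \<alpha>))"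
proof -
  let ?c = "coroot \<Phi> \<alpha>"
  have c: "reflection \<Phi> \<alpha> ?c = - ?c"
    using assms by (simp add: reflection_def vec_eq_iff)
  have "(\<Sum>\<gamma>\<in>\<Phi>. pairing \<gamma> x * pairing \<gamma> ?c)
      = (\<Sum>\<gamma>\<in>\<Phi>. pairing (root_reflection \<Phi> \<alpha> \<gamma>) x * pairing (root_reflection \<Phi> \<alpha> \<gamma>) ?c)"
    by (rule sum.reindex_bij_betw[OF bij_betw_root_reflection[OF assms], symmetric])
  also have "\<dots> = (\<Sum>\<gamma>\<in>\<Phi>. pairing \<alpha> x * (pairing \<gamma> ?c * pairing \<gamma> ?c) - pairing \<gamma> x * pairing \<gamma> ?c)"
    by (intro sum.cong refl, unfold pairing_root_reflection c)
      (simp add: reflection_def pairing_simps algebra_simps)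
  finally show ?thesis
    by (simp add: sum_subtractf flip: sum_distrib_left)
qed

lemma coroot_form_sum:
  "\<alpha> \<in> \<Phi> \<Longrightarrow> \<beta> \<in> \<Phi> \<Longrightarrow>
    of_int (coroot_form \<Phi> \<alpha> \<beta>) = (\<Sum>\<gamma>\<in>\<Phi>. pairing \<gamma> (coroot \<Phi> \<alpha>) * pairing \<gamma> (coroot \<Phi> \<beta>))"
  by (simp add: coroot_form_def cartan_int)

lemma coroot_form_commute: "coroot_form \<Phi> \<alpha> \<beta> = coroot_form \<Phi> \<beta> \<alpha>"
  by (simp add: coroot_form_def mult.commute)

lemma coroot_form_cartan_int:
  assumes "\<alpha> \<in> \<Phi>" "\<beta> \<in> \<Phi>"
  shows "2 * coroot_form \<Phi> \<beta> \<alpha> = cartan_int \<Phi> \<alpha> \<beta> * coroot_form \<Phi> \<alpha> \<alpha>"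
proof -
  have "(of_int (2 * coroot_form \<Phi> \<beta> \<alpha>) :: complex) = of_int (cartan_int \<Phi> \<alpha> \<beta> * coroot_form \<Phi> \<alpha> \<alpha>)"
    using invariant_form_coroot[OF assms(1), of "coroot \<Phi> \<beta>"] assms
    by (simp add: coroot_form_sum cartan_int)
  then show ?thesis by (simp only: of_int_eq_iff)
qed

lemma coroot_form_self_pos:
  assumes "\<alpha> \<in> \<Phi>"
  shows "coroot_form \<Phi> \<alpha> \<alpha> > 0"
  unfolding coroot_form_def
  by (rule sum_pos2[OF finite_roots assms]) (use assms in auto)

text \<open>
  Both Cartan integers of a pair of roots are the same inner product, up to positive factors.
\<close>

lemma cartan_int_pos_commute:
  assumes "\<alpha> \<in> \<Phi>" "\<beta> \<in> \<Phi>" "cartan_int \<Phi> \<alpha> \<beta> > 0"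
  shows "cartan_int \<Phi> \<beta> \<alpha> > 0"
  using coroot_form_cartan_int[OF assms(1,2)] coroot_form_cartan_int[OF assms(2,1)]
    coroot_form_self_pos[OF assms(1)] coroot_form_self_pos[OF assms(2)] assms(3)
  by (metis coroot_form_commute mult_pos_pos zero_less_mult_pos2)

lemma coroot_inj:
  assumes "\<alpha> \<in> \<Phi>" "\<beta> \<in> \<Phi>" "coroot \<Phi> \<alpha> = coroot \<Phi> \<beta>"
  shows "\<alpha> = \<beta>"
proof (rule form_eqI)
  fix x
  have "(\<Sum>\<gamma>\<in>\<Phi>. pairing \<gamma> (coroot \<Phi> \<alpha>) * pairing \<gamma> (coroot \<Phi> \<alpha>)) \<noteq> 0"
    using coroot_form_self_pos[OF assms(1)]
    by (simp add: assms(1) flip: coroot_form_sum)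
  then show "pairing \<alpha> x = pairing \<beta> x"
    using invariant_form_coroot[OF assms(1), of x] invariant_form_coroot[OF assms(2), of x] assms(3)
    by simp
qed

text \<open>
  If neither Cartan integer is \<open>1\<close>, both are at least \<open>2\<close>; then the square length of
  \<open>\<alpha>\<^sup>\<vee> - \<beta>\<^sup>\<vee>\<close> is not positive.
\<close>

lemma cartan_int_eq_1:
  assumes "\<alpha> \<in> \<Phi>" "\<beta> \<in> \<Phi>" "\<alpha> \<noteq> \<beta>" "cartan_int \<Phi> \<alpha> \<beta> > 0"
  shows "cartan_int \<Phi> \<alpha> \<beta> = 1 \<or> cartan_int \<Phi> \<beta> \<alpha> = 1"
proof (rule ccontr)
  assume "\<not> ?thesis"
  then have "cartan_int \<Phi> \<alpha> \<beta> \<ge> 2" "cartan_int \<Phi> \<beta> \<alpha> \<ge> 2"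
    using assms(4) cartan_int_pos_commute[OF assms(1,2,4)] by linarith+
  then have "2 * coroot_form \<Phi> \<alpha> \<alpha> \<le> 2 * coroot_form \<Phi> \<alpha> \<beta>" "2 * coroot_form \<Phi> \<beta> \<beta> \<le> 2 * coroot_form \<Phi> \<alpha> \<beta>"
    using coroot_form_cartan_int[OF assms(1,2)] coroot_form_cartan_int[OF assms(2,1)]
      coroot_form_self_pos[OF assms(1)] coroot_form_self_pos[OF assms(2)]
    by (metis coroot_form_commute mult_right_mono less_imp_le)+
  moreover have "(\<Sum>\<gamma>\<in>\<Phi>. (cartan_int \<Phi> \<gamma> \<alpha> - cartan_int \<Phi> \<gamma> \<beta>)\<^sup>2)
      = coroot_form \<Phi> \<alpha> \<alpha> + coroot_form \<Phi> \<beta> \<beta> - 2 * coroot_form \<Phi> \<alpha> \<beta>"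
    by (simp add: coroot_form_def power2_eq_square algebra_simps sum_subtractf sum.distrib
        sum_distrib_left)
  ultimately have "(\<Sum>\<gamma>\<in>\<Phi>. (cartan_int \<Phi> \<gamma> \<alpha> - cartan_int \<Phi> \<gamma> \<beta>)\<^sup>2) = 0"
    by (smt (verit) sum_nonneg zero_le_power2)
  then have "\<forall>\<gamma>\<in>\<Phi>. cartan_int \<Phi> \<gamma> \<alpha> = cartan_int \<Phi> \<gamma> \<beta>"
    using finite_roots by (simp add: sum_nonneg_eq_0_iff)
  then have "coroot \<Phi> \<alpha> = coroot \<Phi> \<beta>"
    using assms(1,2) by (intro eq_if_pairing_eq_on_spanning[OF span_roots]) (simp add: cartan_int)
  then show False using coroot_inj assms by blast
qed

lemma root_diff:
  assumes "\<alpha> \<in> \<Phi>" "\<beta> \<in> \<Phi>" "\<alpha> \<noteq> \<beta>" "cartan_int \<Phi> \<alpha> \<beta> > 0"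
  shows "\<alpha> - \<beta> \<in> \<Phi>"
  using cartan_int_eq_1[OF assms]
proof
  assume "cartan_int \<Phi> \<alpha> \<beta> = 1"
  then have "root_reflection \<Phi> \<beta> \<alpha> = \<alpha> - \<beta>"
    using assms by (simp add: root_reflection_def cartan_int)
  then show ?thesis using root_reflection_in_roots assms by metis
next
  assume "cartan_int \<Phi> \<beta> \<alpha> = 1"
  then have "root_reflection \<Phi> \<alpha> \<beta> = - (\<alpha> - \<beta>)"
    using assms by (simp add: root_reflection_def cartan_int)
  then show ?thesis using root_reflection_in_roots minus_root assms by (metis minus_minus)
qed

end


section \<open>Affine roots and affine reflections\<close>

text \<open>The pair \<open>(\<beta>, k)\<close> stands for the affine function \<open>\<beta> + k\<close>.\<close>

definition affine_value :: "(complex^'n) \<times> int \<Rightarrow> complex^'n \<Rightarrow> complex" where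
  "affine_value b x = pairing (fst b) x + of_int (snd b)"

definition affine_reflection ::
    "(complex^'n) set \<Rightarrow> (complex^'n) \<times> int \<Rightarrow> complex^'n \<Rightarrow> complex^'n" where
  "affine_reflection \<Phi> b x = x - affine_value b x *s coroot \<Phi> (fst b)"

text \<open>The affine root obtained from \<open>b\<close> by precomposition with the reflection of \<open>c\<close>.\<close>

definition affine_root_reflection ::
    "(complex^'n) set \<Rightarrow> (complex^'n) \<times> int \<Rightarrow> (complex^'n) \<times> int \<Rightarrow> (complex^'n) \<times> int" where
  "affine_root_reflection \<Phi> c b =
     (root_reflection \<Phi> (fst c) (fst b), snd b - cartan_int \<Phi> (fst b) (fst c) * snd c)"

lemma affine_root_eqI:
  assumes "\<And>x. affine_value b x = affine_value c x"
  shows "b = c"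
proof -
  have "snd b = snd c" using assms[of 0] by (simp add: affine_value_def)
  moreover have "fst b = fst c"
    using assms calculation by (intro form_eqI) (simp add: affine_value_def)
  ultimately show ?thesis by (simp add: prod_eq_iff)
qed

context root_sys
begin

abbreviation affine_roots :: "((complex^'n) \<times> int) set" where
  "affine_roots \<equiv> \<Phi> \<times> UNIV"

lemma affine_value_reflection:
  assumes "b \<in> affine_roots" "c \<in> affine_roots"
  shows "affine_value b (affine_reflection \<Phi> c x) = affine_value (affine_root_reflection \<Phi> c b) x"
  using assms
  by (auto simp: affine_value_def affine_reflection_def affine_root_reflection_def
      root_reflection_def pairing_simps cartan_int algebra_simps)

lemma affine_root_reflection_in:
  "b \<in> affine_roots \<Longrightarrow> c \<in> affine_roots \<Longrightarrow> affine_root_reflection \<Phi> c b \<in> affine_roots"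
  by (auto simp: affine_root_reflection_def root_reflection_in_roots)

lemma affine_value_reflection_self:
  "c \<in> affine_roots \<Longrightarrow> affine_value c (affine_reflection \<Phi> c x) = - affine_value c x"
  by (auto simp: affine_value_def affine_reflection_def pairing_simps)

lemma affine_reflection_involution [simp]:
  "c \<in> affine_roots \<Longrightarrow> affine_reflection \<Phi> c (affine_reflection \<Phi> c x) = x"
  by (subst affine_reflection_def) (simp add: affine_value_reflection_self, simp add: affine_reflection_def)

lemma affine_root_reflection_involution [simp]:
  "b \<in> affine_roots \<Longrightarrow> c \<in> affine_roots \<Longrightarrow>
    affine_root_reflection \<Phi> c (affine_root_reflection \<Phi> c b) = b"
  by (rule affine_root_eqI)
    (simp add: affine_root_reflection_in del: mem_Times_iff flip: affine_value_reflection)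

text \<open>
  Conjugating the reflection of \<open>b\<close> by that of \<open>c\<close> gives the reflection of the transformed affine
  root; this is what turns an equality of affine roots into a relation between words below.
\<close>

lemma affine_reflection_conjugate:
  assumes "b \<in> affine_roots" "c \<in> affine_roots"
  shows "affine_reflection \<Phi> b (affine_reflection \<Phi> c x)
    = affine_reflection \<Phi> c (affine_reflection \<Phi> (affine_root_reflection \<Phi> c b) x)"
proof -
  let ?v = "affine_value (affine_root_reflection \<Phi> c b) x"
  have "coroot \<Phi> (fst (affine_root_reflection \<Phi> c b)) = reflection \<Phi> (fst c) (coroot \<Phi> (fst b))"
    using assms by (auto simp: affine_root_reflection_def coroot_root_reflection)
  then have "affine_reflection \<Phi> c (affine_reflection \<Phi> (affine_root_reflection \<Phi> c b) x)
      = affine_reflection \<Phi> c (x - ?v *s reflection \<Phi> (fst c) (coroot \<Phi> (fst b)))"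
    by (simp add: affine_reflection_def)
  also have "\<dots> = affine_reflection \<Phi> c x - ?v *s reflection \<Phi> (fst c) (reflection \<Phi> (fst c) (coroot \<Phi> (fst b)))"
    by (simp add: affine_reflection_def reflection_def affine_value_def pairing_simps vec_eq_iff algebra_simps)
  also have "\<dots> = affine_reflection \<Phi> b (affine_reflection \<Phi> c x)"
    unfolding affine_reflection_def[of \<Phi> b]
    using assms by (simp only: affine_value_reflection) (auto simp: mem_Times_iff)
  finally show ?thesis by simp
qed

lemma affine_reflection_opposite:
  "b \<in> affine_roots \<Longrightarrow> affine_reflection \<Phi> (- fst b, - snd b) = affine_reflection \<Phi> b"
  by (auto simp: fun_eq_iff affine_reflection_def affine_value_def coroot_minus vec_eq_iff algebra_simps)

end


section \<open>Coordinates with respect to the simple affine roots\<close>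

locale based_root_sys = root_sys \<Phi> for \<Phi> :: "(complex^'n) set" +
  fixes \<alpha> :: "nat \<Rightarrow> complex^'n"
  assumes simple_roots: "simple_roots \<Phi> \<alpha>"
    and highest_root: "is_highest_root \<Phi> \<alpha> (- \<alpha> 0)"
begin

lemma alpha_root: "j \<in> {0..CARD('n)} \<Longrightarrow> \<alpha> j \<in> \<Phi>"
proof (cases "j = 0")
  case True
  then show ?thesis using highest_root minus_root[of "- \<alpha> 0"] by (simp add: is_highest_root_def)
next
  case False
  assume "j \<in> {0..CARD('n)}"
  with False show ?thesis using simple_roots by (auto simp: simple_roots_def)
qed

text \<open>
  The basis dual to the simple roots, extended by \<open>0\<close> at the affine vertex, so that the formulas for
  coordinates hold there without a case distinction.
\<close>

definition coweight :: "nat \<Rightarrow> complex^'n" where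
  "coweight = (SOME \<omega>. \<omega> 0 = 0 \<and>
     (\<forall>i\<in>{1..CARD('n)}. \<forall>j\<in>{1..CARD('n)}. pairing (\<alpha> i) (\<omega> j) = (if i = j then 1 else 0)))"

lemma coweight_0 [simp]: "coweight 0 = 0"
  and pairing_coweight: "i \<in> {1..CARD('n)} \<Longrightarrow> j \<in> {1..CARD('n)} \<Longrightarrow>
    pairing (\<alpha> i) (coweight j) = (if i = j then 1 else 0)"
proof -
  have "\<exists>u. \<forall>i\<in>{1..CARD('n)}. pairing (\<alpha> i) u = (if i = j then 1 else 0)" if j: "j \<in> {1..CARD('n)}" for j
  proof -
    have "vec.independent (\<alpha> ` {1..CARD('n)})" and inj: "inj_on \<alpha> {1..CARD('n)}"
      using simple_roots by (auto simp: simple_roots_def)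
    then obtain u where "\<forall>s\<in>\<alpha> ` {1..CARD('n)}. pairing s u = (if s = \<alpha> j then 1 else 0)"
      using ex_vector_with_prescribed_pairings[where g = "\<lambda>s. if s = \<alpha> j then 1 else 0"] by blast
    with inj j show ?thesis by (intro exI[of _ u]) (auto dest: inj_onD)
  qed
  then obtain u where "\<forall>j\<in>{1..CARD('n)}. \<forall>i\<in>{1..CARD('n)}. pairing (\<alpha> i) (u j) = (if i = j then 1 else 0)"
    by metis
  then have "\<exists>\<omega>. \<omega> 0 = 0 \<and>
     (\<forall>i\<in>{1..CARD('n)}. \<forall>j\<in>{1..CARD('n)}. pairing (\<alpha> i) (\<omega> j) = (if i = j then 1 else 0))"
    by (intro exI[of _ "\<lambda>j. if j = 0 then 0 else u j"]) auto
  from someI_ex[OF this] show "coweight 0 = 0"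
    "i \<in> {1..CARD('n)} \<Longrightarrow> j \<in> {1..CARD('n)} \<Longrightarrow>
      pairing (\<alpha> i) (coweight j) = (if i = j then 1 else 0)"
    unfolding coweight_def by blast+
qed

lemma pairing_sum_simple:
  "j \<in> {1..CARD('n)} \<Longrightarrow> pairing (\<Sum>i\<in>{1..CARD('n)}. c i *s \<alpha> i) (coweight j) = c j"
  by (simp add: pairing_sum_left pairing_scale_left pairing_coweight if_distrib cong: if_cong)

lemma nonneg_comb_coweight:
  assumes "nonneg_comb \<alpha> \<beta>"
  obtains k :: "nat \<Rightarrow> nat" where "\<And>j. j \<in> {1..CARD('n)} \<Longrightarrow> pairing \<beta> (coweight j) = of_nat (k j)"
    and "\<beta> = (\<Sum>j\<in>{1..CARD('n)}. pairing \<beta> (coweight j) *s \<alpha> j)"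
proof -
  obtain k :: "nat \<Rightarrow> nat" where k: "\<beta> = (\<Sum>j\<in>{1..CARD('n)}. of_nat (k j) *s \<alpha> j)"
    using assms by (auto simp: nonneg_comb_def)
  have kj: "pairing \<beta> (coweight j) = of_nat (k j)" if "j \<in> {1..CARD('n)}" for j
    unfolding k by (rule pairing_sum_simple[OF that])
  show ?thesis by (rule that[of k]) (use k kj in auto)
qed

definition root_coord :: "complex^'n \<Rightarrow> nat \<Rightarrow> int" where
  "root_coord \<beta> j = \<lfloor>Re (pairing \<beta> (coweight j))\<rfloor>"

lemma root_coord_props:
  assumes "\<beta> \<in> \<Phi>"
  shows "(\<forall>j\<in>{0..CARD('n)}. pairing \<beta> (coweight j) = of_int (root_coord \<beta> j)) \<and>
    \<beta> = (\<Sum>j\<in>{1..CARD('n)}. of_int (root_coord \<beta> j) *s \<alpha> j) \<and>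
    ((\<forall>j\<in>{0..CARD('n)}. root_coord \<beta> j \<ge> 0) \<or> (\<forall>j\<in>{0..CARD('n)}. root_coord \<beta> j \<le> 0))"
proof -
  consider "nonneg_comb \<alpha> \<beta>" | "nonneg_comb \<alpha> (- \<beta>)"
    using assms simple_roots by (auto simp: simple_roots_def)
  then show ?thesis
  proof cases
    case 1
    from nonneg_comb_coweight[OF this] obtain k :: "nat \<Rightarrow> nat" where
      k: "\<And>j. j \<in> {1..CARD('n)} \<Longrightarrow> pairing \<beta> (coweight j) = of_nat (k j)"
      and \<beta>: "\<beta> = (\<Sum>j\<in>{1..CARD('n)}. pairing \<beta> (coweight j) *s \<alpha> j)" by blast
    have c: "root_coord \<beta> j = (if j = 0 then 0 else int (k j)) \<and> pairing \<beta> (coweight j) = of_int (root_coord \<beta> j)"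
      if "j \<in> {0..CARD('n)}" for j
      using that k[of j] by (cases "j = 0") (auto simp: root_coord_def)
    with \<beta> have "\<beta> = (\<Sum>j\<in>{1..CARD('n)}. of_int (root_coord \<beta> j) *s \<alpha> j)" by simp
    with c show ?thesis by auto
  next
    case 2
    from nonneg_comb_coweight[OF this] obtain k :: "nat \<Rightarrow> nat" where
      k: "\<And>j. j \<in> {1..CARD('n)} \<Longrightarrow> - pairing \<beta> (coweight j) = of_nat (k j)"
      and \<beta>: "- \<beta> = (\<Sum>j\<in>{1..CARD('n)}. - pairing \<beta> (coweight j) *s \<alpha> j)" by auto
    have k': "pairing \<beta> (coweight j) = - of_nat (k j)" if "j \<in> {1..CARD('n)}" for j
      using k[OF that] by (metis minus_minus)
    have c: "root_coord \<beta> j = (if j = 0 then 0 else - int (k j)) \<and> pairing \<beta> (coweight j) = of_int (root_coord \<beta> j)"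
      if "j \<in> {0..CARD('n)}" for j
    proof (cases "j = 0")
      case True
      then show ?thesis by (simp add: root_coord_def)
    next
      case False
      with that have "pairing \<beta> (coweight j) = of_int (- int (k j))" using k'[of j] by simp
      then show ?thesis using False by (metis root_coord_def floor_of_int Re_complex_of_real of_real_of_int_eq)
    qed
    have "- \<beta> = - (\<Sum>j\<in>{1..CARD('n)}. of_int (root_coord \<beta> j) *s \<alpha> j)"
      using \<beta> c by (simp add: sum_negf)
    then have "\<beta> = (\<Sum>j\<in>{1..CARD('n)}. of_int (root_coord \<beta> j) *s \<alpha> j)" by simp
    with c show ?thesis by auto
  qed
qed

lemma root_coord: "\<beta> \<in> \<Phi> \<Longrightarrow> j \<in> {0..CARD('n)} \<Longrightarrow> pairing \<beta> (coweight j) = of_int (root_coord \<beta> j)"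
  using root_coord_props by blast

lemma root_coord_expansion: "\<beta> \<in> \<Phi> \<Longrightarrow> \<beta> = (\<Sum>j\<in>{1..CARD('n)}. of_int (root_coord \<beta> j) *s \<alpha> j)"
  using root_coord_props by blast

lemma root_coord_sign:
  "\<beta> \<in> \<Phi> \<Longrightarrow> (\<forall>j\<in>{0..CARD('n)}. root_coord \<beta> j \<ge> 0) \<or> (\<forall>j\<in>{0..CARD('n)}. root_coord \<beta> j \<le> 0)"
  by (rule root_coord_props[THEN conjunct2, THEN conjunct2])

lemma root_coord_0 [simp]: "root_coord \<beta> 0 = 0"
  by (simp add: root_coord_def)

lemma root_coord_minus:
  assumes "\<beta> \<in> \<Phi>" "j \<in> {0..CARD('n)}"
  shows "root_coord (- \<beta>) j = - root_coord \<beta> j"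
proof -
  have "(of_int (root_coord (- \<beta>) j) :: complex) = of_int (- root_coord \<beta> j)"
    using root_coord[OF assms] root_coord[OF minus_root[OF assms(1)] assms(2)] by simp
  then show ?thesis by (simp only: of_int_eq_iff)
qed

text \<open>
  The coefficients of the highest root, completed by \<open>1\<close> at the affine vertex, so that the
  constant function \<open>1\<close> is the sum of the simple affine roots weighted with these marks.
\<close>

definition mark :: "nat \<Rightarrow> int" where
  "mark j = (if j = 0 then 1 else root_coord (- \<alpha> 0) j)"

lemma root_coord_le_mark:
  assumes "\<beta> \<in> \<Phi>" "j \<in> {1..CARD('n)}"
  shows "root_coord \<beta> j \<le> mark j"
proof -
  have "nonneg_comb \<alpha> (- \<alpha> 0 - \<beta>)" and \<theta>: "- \<alpha> 0 \<in> \<Phi>"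
    using highest_root assms(1) by (auto simp: is_highest_root_def)
  from nonneg_comb_coweight[OF this(1)] obtain k :: "nat \<Rightarrow> nat" where
    "\<And>j. j \<in> {1..CARD('n)} \<Longrightarrow> pairing (- \<alpha> 0 - \<beta>) (coweight j) = of_nat (k j)"
    by blast
  from this[OF assms(2)] have "of_int (mark j - root_coord \<beta> j) = (of_nat (k j) :: complex)"
    using root_coord[OF \<theta>, of j] root_coord[OF assms(1), of j] assms(2)
    by (simp add: mark_def pairing_diff_left)
  then have "mark j - root_coord \<beta> j = int (k j)"
    by (metis of_int_eq_iff of_int_of_nat_eq)
  then show ?thesis by simp
qed

lemma mark_pos:
  assumes "j \<in> {0..CARD('n)}"
  shows "mark j > 0"
proof (cases "j = 0")
  case False
  with assms have j: "j \<in> {1..CARD('n)}" by auto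
  have "of_int (root_coord (\<alpha> j) j) = (1 :: complex)"
    using root_coord[OF alpha_root[OF assms] assms] pairing_coweight[OF j j] by simp
  then show ?thesis using root_coord_le_mark[OF alpha_root[OF assms] j] by simp
qed (simp add: mark_def)

definition simple_affine :: "nat \<Rightarrow> (complex^'n) \<times> int" where
  "simple_affine j = (\<alpha> j, if j = 0 then 1 else 0)"

definition affine_coord :: "(complex^'n) \<times> int \<Rightarrow> nat \<Rightarrow> int" where
  "affine_coord b j = root_coord (fst b) j + snd b * mark j"

definition positive_affine :: "(complex^'n) \<times> int \<Rightarrow> bool" where
  "positive_affine b \<longleftrightarrow> (\<forall>j\<in>{0..CARD('n)}. affine_coord b j \<ge> 0)"

lemma fst_simple_affine [simp]: "fst (simple_affine j) = \<alpha> j"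
  by (simp add: simple_affine_def)

lemma simple_affine_in: "j \<in> {0..CARD('n)} \<Longrightarrow> simple_affine j \<in> affine_roots"
  by (simp add: simple_affine_def alpha_root)

lemma affine_coord_0 [simp]: "affine_coord b 0 = snd b"
  by (simp add: affine_coord_def mark_def)

lemma pairing_alpha_0:
  assumes "j \<in> {0..CARD('n)}"
  shows "pairing (\<alpha> 0) (coweight j) = of_int ((if j = 0 then 1 else 0) - mark j)"
proof -
  have "- pairing (\<alpha> 0) (coweight j) = of_int (root_coord (- \<alpha> 0) j)"
    using root_coord[OF minus_root[OF alpha_root[of 0]] assms] by simp
  then have "pairing (\<alpha> 0) (coweight j) = - of_int (root_coord (- \<alpha> 0) j)"
    by (metis minus_minus)
  then show ?thesis by (cases "j = 0") (auto simp: mark_def)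
qed

lemma of_int_affine_coord:
  "b \<in> affine_roots \<Longrightarrow> j \<in> {0..CARD('n)} \<Longrightarrow>
    of_int (affine_coord b j) = pairing (fst b) (coweight j) + of_int (snd b * mark j)"
  by (auto simp: affine_coord_def root_coord)

lemma affine_coord_simple:
  assumes "i \<in> {0..CARD('n)}" "j \<in> {0..CARD('n)}"
  shows "affine_coord (simple_affine i) j = (if i = j then 1 else 0)"
proof -
  have "(of_int (affine_coord (simple_affine i) j) :: complex) = of_int (if i = j then 1 else 0)"
    using assms pairing_coweight[of i j] pairing_alpha_0[of j]
    by (cases "i = 0"; cases "j = 0") (auto simp: of_int_affine_coord simple_affine_in simple_affine_def alpha_root)
  then show ?thesis by (simp only: of_int_eq_iff)
qed

lemma affine_coord_expansion:
  assumes "b \<in> affine_roots"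
  shows "fst b = (\<Sum>j\<in>{0..CARD('n)}. of_int (affine_coord b j) *s \<alpha> j)"
proof -
  have \<theta>: "- \<alpha> 0 \<in> \<Phi>" using alpha_root[of 0] minus_root by simp
  have "(\<Sum>j\<in>{0..CARD('n)}. of_int (affine_coord b j) *s \<alpha> j)
      = of_int (snd b) *s \<alpha> 0 + (\<Sum>j\<in>{1..CARD('n)}. of_int (affine_coord b j) *s \<alpha> j)"
    by (simp add: sum.atLeast_Suc_atMost)
  also have "(\<Sum>j\<in>{1..CARD('n)}. of_int (affine_coord b j) *s \<alpha> j)
      = (\<Sum>j\<in>{1..CARD('n)}. of_int (root_coord (fst b) j) *s \<alpha> j
          + of_int (snd b) *s (of_int (root_coord (- \<alpha> 0) j) *s \<alpha> j))"
    by (intro sum.cong) (auto simp: affine_coord_def mark_def vec.scale_left_distrib)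
  also have "\<dots> = fst b + of_int (snd b) *s (- \<alpha> 0)"
    unfolding sum.distrib vec.scale_sum_right[symmetric]
    using root_coord_expansion[of "fst b"] root_coord_expansion[OF \<theta>] assms
    by (auto simp only: mem_Times_iff)
  finally show ?thesis by (simp add: vec.scale_minus_right)
qed

text \<open>
  On the alcove, where the simple affine roots are nonnegative, the sign of an affine root is thereby
  the common sign of its coordinates.
\<close>

lemma affine_value_expansion:
  assumes "b \<in> affine_roots"
  shows "affine_value b x = (\<Sum>j\<in>{0..CARD('n)}. of_int (affine_coord b j) * affine_value (simple_affine j) x)"
proof -
  have "affine_value b x = (\<Sum>j\<in>{0..CARD('n)}. of_int (affine_coord b j) * pairing (\<alpha> j) x) + of_int (snd b)"
    unfolding affine_value_def by (subst affine_coord_expansion[OF assms]) (simp add: pairing_sum_left pairing_scale_left)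
  also have "of_int (snd b) = (\<Sum>j\<in>{0..CARD('n)}. of_int (affine_coord b j) * of_int (if j = 0 then 1 else 0))"
    by (simp add: if_distrib cong: if_cong)
  finally show ?thesis
    by (simp add: affine_value_def simple_affine_def algebra_simps flip: sum.distrib)
qed

text \<open>
  For \<open>k \<noteq> 0\<close> the sign of the coordinates of \<open>\<beta> + k\<close> is that of \<open>k\<close>: the marks are the coordinates of
  the highest root, hence bound those of every root in absolute value.
\<close>

lemma affine_coord_sign:
  assumes "b \<in> affine_roots"
  shows "positive_affine b \<or> (\<forall>j\<in>{0..CARD('n)}. affine_coord b j \<le> 0)"
proof -
  have b: "fst b \<in> \<Phi>" "- fst b \<in> \<Phi>" using assms minus_root by auto
  have bound: "\<bar>root_coord (fst b) j\<bar> \<le> mark j" if "j \<in> {0..CARD('n)}" for j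
    using that root_coord_le_mark[OF b(1), of j] root_coord_le_mark[OF b(2), of j] root_coord_minus[OF b(1) that]
    by (cases "j = 0") (auto simp: mark_def)
  consider "snd b = 0" | "snd b \<ge> 1" | "snd b \<le> -1" by linarith
  then show ?thesis
  proof cases
    case 1
    then show ?thesis using root_coord_sign[OF b(1)] by (auto simp: positive_affine_def affine_coord_def)
  next
    case 2
    have "affine_coord b j \<ge> 0" if "j \<in> {0..CARD('n)}" for j
    proof -
      have "1 * mark j \<le> snd b * mark j"
        by (rule mult_right_mono) (use 2 mark_pos[OF that] in auto)
      then show ?thesis using bound[OF that] unfolding affine_coord_def by linarith
    qed
    then show ?thesis by (simp add: positive_affine_def)
  next
    case 3
    have "affine_coord b j \<le> 0" if "j \<in> {0..CARD('n)}" for j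
    proof -
      have "snd b * mark j \<le> -1 * mark j"
        by (rule mult_right_mono) (use 3 mark_pos[OF that] in auto)
      then show ?thesis using bound[OF that] unfolding affine_coord_def by linarith
    qed
    then show ?thesis by simp
  qed
qed

lemma affine_coord_opposite:
  assumes "b \<in> affine_roots" "j \<in> {0..CARD('n)}"
  shows "affine_coord (- fst b, - snd b) j = - affine_coord b j"
  using assms by (auto simp: affine_coord_def root_coord_minus)

lemma affine_coord_reflection:
  assumes "b \<in> affine_roots" "i \<in> {0..CARD('n)}" "j \<in> {0..CARD('n)}"
  shows "affine_coord (affine_root_reflection \<Phi> (simple_affine i) b) j
    = affine_coord b j - (if i = j then cartan_int \<Phi> (fst b) (\<alpha> i) else 0)"
proof -
  let ?c = "cartan_int \<Phi> (fst b) (\<alpha> i)"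
  have "(of_int (affine_coord (affine_root_reflection \<Phi> (simple_affine i) b) j) :: complex)
      = of_int (affine_coord b j) - of_int ?c * of_int (affine_coord (simple_affine i) j)"
  proof -
    have "pairing (fst b) (coroot \<Phi> (\<alpha> i)) = of_int ?c"
      using assms(1) alpha_root[OF assms(2)] by (intro cartan_int) auto
    then show ?thesis
      unfolding of_int_affine_coord[OF affine_root_reflection_in[OF assms(1) simple_affine_in[OF assms(2)]] assms(3)]
        of_int_affine_coord[OF assms(1,3)] of_int_affine_coord[OF simple_affine_in[OF assms(2)] assms(3)]
      by (simp add: affine_root_reflection_def root_reflection_def pairing_diff_left pairing_scale_left algebra_simps)
  qed
  also have "\<dots> = of_int (affine_coord b j - ?c * affine_coord (simple_affine i) j)" by simp
  finally show ?thesis using assms by (simp only: of_int_eq_iff) (simp add: affine_coord_simple)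
qed

text \<open>
  A simple affine reflection changes a single coordinate.  A positive affine root other than
  \<open>simple_affine i\<close> has another positive coordinate, because the root system is reduced;
  since all coordinates have the same sign, it stays positive.  All arguments about words rest on
  this fact.
\<close>

lemma pos_reflection:
  assumes b: "b \<in> affine_roots" and i: "i \<in> {0..CARD('n)}" and "positive_affine b" "b \<noteq> simple_affine i"
  shows "positive_affine (affine_root_reflection \<Phi> (simple_affine i) b)"
proof -
  have "\<exists>j\<in>{0..CARD('n)}. j \<noteq> i \<and> affine_coord b j > 0"
  proof (rule ccontr)
    assume "\<not> ?thesis"
    then have zero: "affine_coord b j = 0" if "j \<in> {0..CARD('n)}" "j \<noteq> i" for j
      using that \<open>positive_affine b\<close> by (force simp: positive_affine_def)
    have fst_b: "fst b = of_int (affine_coord b i) *s \<alpha> i"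
    proof -
      have "fst b = (\<Sum>j\<in>{0..CARD('n)}. if j = i then of_int (affine_coord b i) *s \<alpha> i else 0)"
        unfolding affine_coord_expansion[OF b] by (intro sum.cong) (auto simp: zero)
      with i show ?thesis by simp
    qed
    then have "of_int (affine_coord b i) = (1::complex) \<or> of_int (affine_coord b i) = (-1::complex)"
      using reduced[OF alpha_root[OF i]] b by (metis mem_Times_iff)
    then have "affine_coord b i = 1 \<or> affine_coord b i = -1"
      by (metis of_int_eq_iff of_int_1 of_int_minus)
    then have 1: "affine_coord b i = 1"
      using \<open>positive_affine b\<close> i unfolding positive_affine_def by fastforce
    have "snd b = (if i = 0 then 1 else 0)"
      using zero[of 0] 1 by (cases "i = 0") auto
    with 1 fst_b have "b = simple_affine i" by (simp add: simple_affine_def prod_eq_iff)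
    with assms(4) show False ..
  qed
  then obtain j where j: "j \<in> {0..CARD('n)}" "j \<noteq> i" "affine_coord b j > 0" by blast
  then have "affine_coord (affine_root_reflection \<Phi> (simple_affine i) b) j > 0"
    using affine_coord_reflection[OF b i j(1)] by simp
  with j(1) show ?thesis
    using affine_coord_sign[OF affine_root_reflection_in[OF b simple_affine_in[OF i]]] by fastforce
qed

lemma pos_simple_affine: "i \<in> {0..CARD('n)} \<Longrightarrow> positive_affine (simple_affine i)"
  by (simp add: positive_affine_def affine_coord_simple)

lemma not_pos_opposite_simple:
  assumes "i \<in> {0..CARD('n)}"
  shows "\<not> positive_affine (affine_root_reflection \<Phi> (simple_affine i) (simple_affine i))"
proof -
  have "affine_coord (affine_root_reflection \<Phi> (simple_affine i) (simple_affine i)) i = -1"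
    using affine_coord_reflection[OF simple_affine_in[OF assms] assms assms]
      affine_coord_simple[OF assms assms] alpha_root[OF assms] by simp
  then show ?thesis using assms unfolding positive_affine_def by fastforce
qed

end


section \<open>Words in the simple affine reflections\<close>

context based_root_sys
begin

primrec word_act :: "nat list \<Rightarrow> complex^'n \<Rightarrow> complex^'n" where
  "word_act [] x = x"
| "word_act (i # w) x = affine_reflection \<Phi> (simple_affine i) (word_act w x)"

text \<open>The affine root obtained from \<open>b\<close> by precomposition with \<open>word_act w\<close>.\<close>

primrec word_pull :: "nat list \<Rightarrow> (complex^'n) \<times> int \<Rightarrow> (complex^'n) \<times> int" where
  "word_pull [] b = b"
| "word_pull (i # w) b = word_pull w (affine_root_reflection \<Phi> (simple_affine i) b)"

lemma word_act_append: "word_act (u @ v) x = word_act u (word_act v x)"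
  by (induction u) auto

lemma word_pull_append: "word_pull (u @ v) b = word_pull v (word_pull u b)"
  by (induction u arbitrary: b) auto

lemma word_pull_in: "set w \<subseteq> {0..CARD('n)} \<Longrightarrow> b \<in> affine_roots \<Longrightarrow> word_pull w b \<in> affine_roots"
proof (induction w arbitrary: b)
  case (Cons i w)
  then show ?case using affine_root_reflection_in[OF Cons.prems(2) simple_affine_in[of i]] by simp
qed simp

lemma affine_value_word_act:
  "set w \<subseteq> {0..CARD('n)} \<Longrightarrow> b \<in> affine_roots \<Longrightarrow> affine_value b (word_act w x) = affine_value (word_pull w b) x"
proof (induction w arbitrary: b)
  case (Cons i w)
  then show ?case
    using affine_root_reflection_in[OF Cons.prems(2) simple_affine_in[of i]]
      affine_value_reflection[OF Cons.prems(2) simple_affine_in[of i]] by simp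
qed simp

lemma affine_reflection_word_act:
  "set w \<subseteq> {0..CARD('n)} \<Longrightarrow> b \<in> affine_roots \<Longrightarrow>
    affine_reflection \<Phi> b (word_act w x) = word_act w (affine_reflection \<Phi> (word_pull w b) x)"
proof (induction w arbitrary: b)
  case (Cons i w)
  then show ?case
    using affine_root_reflection_in[OF Cons.prems(2) simple_affine_in[of i]]
      affine_reflection_conjugate[OF Cons.prems(2) simple_affine_in[of i]] by simp
qed simp

text \<open>
  The exchange argument: follow the affine root \<open>simple_affine i\<close> along the word.  It starts
  positive and ends negative, so at one letter \<open>j\<close> it changes sign, which is possible only if it
  has become \<open>simple_affine j\<close>.  Then the reflection \<open>i\<close> in front cancels this letter \<open>j\<close>.
\<close>

lemma deletion:
  assumes "set w \<subseteq> {0..CARD('n)}" "i \<in> {0..CARD('n)}" "\<not> positive_affine (word_pull w (simple_affine i))"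
  shows "\<exists>u. set u \<subseteq> {0..CARD('n)} \<and> length u < length w \<and>
    (\<forall>x. word_act u x = affine_reflection \<Phi> (simple_affine i) (word_act w x))"
  using assms
proof (induction w rule: rev_induct)
  case Nil
  then show ?case using pos_simple_affine by simp
next
  case (snoc j w)
  have w: "set w \<subseteq> {0..CARD('n)}" and j: "j \<in> {0..CARD('n)}" using snoc.prems by auto
  let ?b = "word_pull w (simple_affine i)"
  show ?case
  proof (cases "positive_affine ?b")
    case False
    with snoc.IH w snoc.prems obtain u where u: "set u \<subseteq> {0..CARD('n)}" "length u < length w"
      "\<forall>x. word_act u x = affine_reflection \<Phi> (simple_affine i) (word_act w x)" by blast
    then show ?thesis using j by (intro exI[of _ "u @ [j]"]) (auto simp: word_act_append)
  next
    case True
    have b: "?b \<in> affine_roots"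
      by (rule word_pull_in[OF w simple_affine_in[OF snoc.prems(2)]])
    have "\<not> positive_affine (affine_root_reflection \<Phi> (simple_affine j) ?b)"
      using snoc.prems(3) by (simp add: word_pull_append)
    then have "?b = simple_affine j"
      using pos_reflection[OF b j True] by blast
    then have "affine_reflection \<Phi> (simple_affine i) (word_act (w @ [j]) x) = word_act w x" for x
      using affine_reflection_word_act[OF w simple_affine_in[OF snoc.prems(2)]] simple_affine_in[OF j]
      by (simp add: word_act_append)
    then show ?thesis using w by (intro exI[of _ w]) auto
  qed
qed


section \<open>The fundamental alcove\<close>

definition alcove :: "(complex^'n) set" where
  "alcove = {y. \<forall>j\<in>{0..CARD('n)}. 0 \<le> affine_value (simple_affine j) y}"

definition walls_at :: "complex^'n \<Rightarrow> nat set" where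
  "walls_at y = {j \<in> {0..CARD('n)}. affine_value (simple_affine j) y = 0}"

lemma pos_nonneg_on_alcove:
  assumes "b \<in> affine_roots" "positive_affine b" "y \<in> alcove"
  shows "0 \<le> affine_value b y"
  unfolding affine_value_expansion[OF assms(1)]
proof (intro sum_nonneg mult_nonneg_nonneg)
  fix j assume j: "j \<in> {0..CARD('n)}"
  then show "0 \<le> affine_value (simple_affine j) y" using assms(3) by (simp add: alcove_def)
  show "0 \<le> (of_int (affine_coord b j) :: complex)"
    using assms(2) j by (simp add: positive_affine_def less_eq_complex_def)
qed

lemma word_act_fixes:
  "set v \<subseteq> walls_at y \<Longrightarrow> word_act v y = y"
  by (induction v) (auto simp: walls_at_def affine_reflection_def)

text \<open>
  Remove the first letter \<open>i\<close>: either the word can be shortened, or the rest of the word maps the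
  alcove to the positive side of the wall \<open>i\<close> and the whole word to the negative side, so that the
  image of \<open>y\<close> lies on this wall and is not moved by the last reflection.  In particular, points
  of the alcove are equivalent under the affine Weyl group only if they are equal.
\<close>

theorem alcove_stabilizer:
  assumes "set w \<subseteq> {0..CARD('n)}" "y \<in> alcove" "word_act w y \<in> alcove"
  shows "\<exists>v. set v \<subseteq> walls_at y \<and> (\<forall>x. word_act w x = word_act v x)"
  using assms
proof (induction "length w" arbitrary: w rule: less_induct)
  case less
  show ?case
  proof (cases w)
    case Nil
    then show ?thesis by (intro exI[of _ "[]"]) simp
  next
    case (Cons i u)
    with less.prems have u: "set u \<subseteq> {0..CARD('n)}" and i: "i \<in> {0..CARD('n)}" by auto
    let ?b = "word_pull u (simple_affine i)"
    show ?thesis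
    proof (cases "positive_affine ?b")
      case False
      with deletion[OF u i] obtain v where v: "set v \<subseteq> {0..CARD('n)}" "length v < length u"
        "\<forall>x. word_act v x = word_act w x" by (auto simp: Cons)
      have "length v < length w" "word_act v y \<in> alcove" using v less.prems Cons by auto
      from less.hyps[OF this(1) v(1) less.prems(2) this(2)] v(3) show ?thesis by auto
    next
      case True
      have b: "?b \<in> affine_roots"
        by (rule word_pull_in[OF u simple_affine_in[OF i]])
      have "affine_value (simple_affine i) (word_act u y) = affine_value ?b y"
        by (rule affine_value_word_act[OF u simple_affine_in[OF i]])
      with pos_nonneg_on_alcove[OF b True less.prems(2)]
      have "0 \<le> affine_value (simple_affine i) (word_act u y)" by simp
      moreover have "0 \<le> affine_value (simple_affine i) (word_act w y)"
        using less.prems(3) i by (simp add: alcove_def)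
      then have "affine_value (simple_affine i) (word_act u y) \<le> 0"
        using affine_value_reflection_self[OF simple_affine_in[OF i]]
        by (simp add: Cons less_eq_complex_def)
      ultimately have zero: "affine_value (simple_affine i) (word_act u y) = 0" by simp
      then have wu: "word_act w y = word_act u y"
        by (simp add: Cons affine_reflection_def)
      then have "word_act u y \<in> alcove" using less.prems(3) by simp
      moreover have "length u < length w" by (simp add: Cons)
      ultimately obtain v where v: "set v \<subseteq> walls_at y" "\<forall>x. word_act u x = word_act v x"
        using less.hyps u less.prems(2) by blast
      have "word_act u y = y" using v word_act_fixes by simp
      with zero i have "i \<in> walls_at y" by (simp add: walls_at_def)
      with v show ?thesis by (intro exI[of _ "i # v"]) (auto simp: Cons)
    qed
  qed
qed

text \<open>
  The real form of the Cartan subalgebra, on which sides of hyperplanes make sense.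
\<close>

definition real_points :: "(complex^'n) set" where
  "real_points = {y. \<forall>\<beta>\<in>\<Phi>. pairing \<beta> y \<in> \<real>}"

lemma real_points_affine_value: "y \<in> real_points \<Longrightarrow> b \<in> affine_roots \<Longrightarrow> affine_value b y \<in> \<real>"
  by (auto simp: real_points_def affine_value_def)

lemma real_points_reflection:
  assumes "y \<in> real_points" "b \<in> affine_roots"
  shows "affine_reflection \<Phi> b y \<in> real_points"
  unfolding real_points_def
proof safe
  fix \<beta> assume "\<beta> \<in> \<Phi>"
  then have "(\<beta>, 0::int) \<in> affine_roots" by simp
  from affine_value_reflection[OF this assms(2), of y]
    real_points_affine_value[OF assms(1) affine_root_reflection_in[OF this assms(2)]]
  show "pairing \<beta> (affine_reflection \<Phi> b y) \<in> \<real>" by (simp add: affine_value_def)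
qed

text \<open>Each separating hyperplane is represented by its affine root that is nonnegative on the alcove.\<close>

definition separating :: "complex^'n \<Rightarrow> ((complex^'n) \<times> int) set" where
  "separating y = {b \<in> affine_roots. positive_affine b \<and> affine_value b y < 0}"

lemma finite_separating: "finite (separating y)"
proof (rule finite_subset)
  show "separating y \<subseteq> (SIGMA \<beta>:\<Phi>. {0..\<lceil>- Re (pairing \<beta> y)\<rceil>})"
  proof
    fix b assume "b \<in> separating y"
    then have "b \<in> affine_roots" "positive_affine b" and neg: "affine_value b y < 0"
      unfolding separating_def by blast+
    then have "fst b \<in> \<Phi>" by auto
    moreover have "affine_coord b 0 \<ge> 0"
      using \<open>positive_affine b\<close> unfolding positive_affine_def by (rule bspec) simp
    moreover have "Re (pairing (fst b) y) + of_int (snd b) < 0"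
      using neg by (simp add: affine_value_def less_complex_def)
    ultimately have b: "fst b \<in> \<Phi>" "snd b \<ge> 0" "Re (pairing (fst b) y) + of_int (snd b) < 0"
      by simp_all
    then show "b \<in> (SIGMA \<beta>:\<Phi>. {0..\<lceil>- Re (pairing \<beta> y)\<rceil>})"
      by (cases b) (auto simp: le_ceiling_iff)
  qed
  show "finite (SIGMA \<beta>:\<Phi>. {0..\<lceil>- Re (pairing \<beta> y)\<rceil>})"
    using finite_roots by auto
qed

text \<open>
  The reflection in a wall that separates \<open>y\<close> from the alcove permutes the other positive affine
  roots, hence removes exactly this wall from the separating hyperplanes.
\<close>

lemma card_separating_reflection:
  assumes i: "i \<in> {0..CARD('n)}" and neg: "affine_value (simple_affine i) y < 0"
  shows "card (separating (affine_reflection \<Phi> (simple_affine i) y)) < card (separating y)"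
proof -
  let ?a = "simple_affine i" and ?r = "affine_root_reflection \<Phi> (simple_affine i)"
  note a = simple_affine_in[OF i]
  have "inj_on ?r (separating (affine_reflection \<Phi> ?a y))"
  proof (rule inj_on_inverseI[where g = ?r])
    fix b assume "b \<in> separating (affine_reflection \<Phi> ?a y)"
    then have "b \<in> affine_roots" unfolding separating_def by blast
    then show "?r (?r b) = b" using a by (rule affine_root_reflection_involution)
  qed
  moreover have "?r b \<in> separating y - {?a}" if "b \<in> separating (affine_reflection \<Phi> ?a y)" for b
  proof -
    have b: "b \<in> affine_roots" "positive_affine b" "affine_value b (affine_reflection \<Phi> ?a y) < 0"
      using that unfolding separating_def by blast+
    have "b \<noteq> ?a" using b(3) neg affine_value_reflection_self[OF a, of y] by (auto simp: less_complex_def)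
    then have "positive_affine (?r b)" using pos_reflection[OF b(1) i b(2)] by simp
    moreover have "?r b \<noteq> ?a"
      using not_pos_opposite_simple[OF i] b(2) affine_root_reflection_involution[OF b(1) a] by metis
    ultimately show ?thesis
      using b(3) affine_root_reflection_in[OF b(1) a] affine_value_reflection[OF b(1) a]
      unfolding separating_def by simp
  qed
  then have "?r ` separating (affine_reflection \<Phi> ?a y) \<subseteq> separating y - {?a}"
    by (rule image_subsetI)
  ultimately have "card (separating (affine_reflection \<Phi> ?a y)) \<le> card (separating y - {?a})"
    by (rule card_inj_on_le) (simp add: finite_separating)
  moreover have "?a \<in> separating y"
    using a neg pos_simple_affine[OF i] unfolding separating_def by blast
  ultimately show ?thesis
    using card_Diff1_less[OF finite_separating] by (meson order_le_less_trans)
qed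

text \<open>
  Reflecting in a wall on whose negative side \<open>y\<close> lies brings \<open>y\<close> closer to the alcove, as measured by
  the number of separating hyperplanes.
\<close>

theorem ex_word_into_alcove:
  assumes "y \<in> real_points"
  shows "\<exists>w. set w \<subseteq> {0..CARD('n)} \<and> word_act w y \<in> alcove"
  using assms
proof (induction "card (separating y)" arbitrary: y rule: less_induct)
  case less
  show ?case
  proof (cases "y \<in> alcove")
    case True
    then show ?thesis by (intro exI[of _ "[]"]) simp
  next
    case False
    then obtain i where i: "i \<in> {0..CARD('n)}" "\<not> 0 \<le> affine_value (simple_affine i) y"
      by (auto simp: alcove_def)
    have "affine_value (simple_affine i) y \<in> \<real>"
      by (rule real_points_affine_value[OF less.prems simple_affine_in[OF i(1)]])
    with i(2) have neg: "affine_value (simple_affine i) y < 0"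
      by (auto simp: less_complex_def less_eq_complex_def complex_is_Real_iff)
    let ?y = "affine_reflection \<Phi> (simple_affine i) y"
    obtain w where "set w \<subseteq> {0..CARD('n)}" "word_act w ?y \<in> alcove"
      using less.hyps[OF card_separating_reflection[OF i(1) neg]
          real_points_reflection[OF less.prems simple_affine_in[OF i(1)]]] by blast
    with i(1) show ?thesis by (intro exI[of _ "w @ [i]"]) (auto simp: word_act_append)
  qed
qed


section \<open>Every affine reflection is a word in the simple ones\<close>

text \<open>
  Pairing the expansion of \<open>fst b\<close> in the simple affine roots with the coroot of \<open>fst b\<close> gives \<open>2\<close>, so
  some term of the expansion contributes positively.
\<close>

lemma ex_simple_with_positive_cartan_int:
  assumes "b \<in> affine_roots" "positive_affine b"
  shows "\<exists>j\<in>{0..CARD('n)}. affine_coord b j > 0 \<and> cartan_int \<Phi> (fst b) (\<alpha> j) > 0"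
proof (rule ccontr)
  assume not: "\<not> ?thesis"
  have b: "fst b \<in> \<Phi>" using assms by auto
  have "affine_coord b j * cartan_int \<Phi> (\<alpha> j) (fst b) \<le> 0" if j: "j \<in> {0..CARD('n)}" for j
  proof (cases "affine_coord b j > 0")
    case True
    then have "\<not> cartan_int \<Phi> (\<alpha> j) (fst b) > 0"
      using not j cartan_int_pos_commute[OF alpha_root[OF j] b] by blast
    with True show ?thesis by (simp add: mult_le_0_iff)
  next
    case False
    with assms(2) j have "affine_coord b j = 0" by (force simp: positive_affine_def)
    then show ?thesis by simp
  qed
  then have "(\<Sum>j\<in>{0..CARD('n)}. affine_coord b j * cartan_int \<Phi> (\<alpha> j) (fst b)) \<le> 0"
    by (intro sum_nonpos) auto
  moreover have "(of_int (\<Sum>j\<in>{0..CARD('n)}. affine_coord b j * cartan_int \<Phi> (\<alpha> j) (fst b)) :: complex) = of_int 2"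
  proof -
    have "of_int 2 = pairing (\<Sum>j\<in>{0..CARD('n)}. of_int (affine_coord b j) *s \<alpha> j) (coroot \<Phi> (fst b))"
      using affine_coord_expansion[OF assms(1)] pairing_coroot_self[OF b] by simp
    also have "\<dots> = (\<Sum>j\<in>{0..CARD('n)}. of_int (affine_coord b j * cartan_int \<Phi> (\<alpha> j) (fst b)))"
      unfolding pairing_sum_left pairing_scale_left
      by (intro sum.cong) (simp_all add: cartan_int[OF alpha_root b])
    finally show ?thesis by simp
  qed
  ultimately show False by (simp only: of_int_eq_iff)
qed

text \<open>
  A simple reflection chosen by the previous lemma lowers the height of \<open>b\<close>, the sum of its
  coordinates, and conjugates the reflection of \<open>b\<close> to that of a lower affine root.
\<close>

lemma affine_reflection_is_word_if_pos:
  assumes "b \<in> affine_roots" "positive_affine b"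
  shows "\<exists>w. set w \<subseteq> {0..CARD('n)} \<and> (\<forall>x. affine_reflection \<Phi> b x = word_act w x)"
  using assms
proof (induction "nat (\<Sum>j\<in>{0..CARD('n)}. affine_coord b j)" arbitrary: b rule: less_induct)
  case less
  obtain i where i: "i \<in> {0..CARD('n)}" "cartan_int \<Phi> (fst b) (\<alpha> i) > 0"
    using ex_simple_with_positive_cartan_int[OF less.prems] by blast
  let ?b = "affine_root_reflection \<Phi> (simple_affine i) b"
  note a = simple_affine_in[OF i(1)]
  show ?case
  proof (cases "b = simple_affine i")
    case True
    then show ?thesis using i(1) by (intro exI[of _ "[i]"]) simp
  next
    case False
    have b': "?b \<in> affine_roots" "positive_affine ?b"
      using affine_root_reflection_in[OF less.prems(1) a] pos_reflection[OF less.prems(1) i(1) less.prems(2) False]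
      by blast+
    have "(\<Sum>j\<in>{0..CARD('n)}. affine_coord ?b j)
        = (\<Sum>j\<in>{0..CARD('n)}. affine_coord b j - (if i = j then cartan_int \<Phi> (fst b) (\<alpha> i) else 0))"
      by (intro sum.cong refl affine_coord_reflection[OF less.prems(1) i(1)])
    also have "\<dots> = (\<Sum>j\<in>{0..CARD('n)}. affine_coord b j) - cartan_int \<Phi> (fst b) (\<alpha> i)"
      using i(1) by (simp add: sum_subtractf)
    finally have "(\<Sum>j\<in>{0..CARD('n)}. affine_coord ?b j) < (\<Sum>j\<in>{0..CARD('n)}. affine_coord b j)"
      using i(2) by simp
    moreover have "(\<Sum>j\<in>{0..CARD('n)}. affine_coord ?b j) \<ge> 0"
      using b'(2) by (intro sum_nonneg) (simp add: positive_affine_def)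
    ultimately have "nat (\<Sum>j\<in>{0..CARD('n)}. affine_coord ?b j) < nat (\<Sum>j\<in>{0..CARD('n)}. affine_coord b j)"
      by simp
    from less.hyps[OF this b'] obtain w where w: "set w \<subseteq> {0..CARD('n)}" "\<forall>x. affine_reflection \<Phi> ?b x = word_act w x"
      by blast
    have "affine_reflection \<Phi> b x = word_act ([i] @ w @ [i]) x" for x
    proof -
      have "affine_reflection \<Phi> b x
          = affine_reflection \<Phi> b (affine_reflection \<Phi> (simple_affine i) (affine_reflection \<Phi> (simple_affine i) x))"
        using affine_reflection_involution[OF a] by metis
      also have "\<dots> = affine_reflection \<Phi> (simple_affine i) (affine_reflection \<Phi> ?b (affine_reflection \<Phi> (simple_affine i) x))"
        by (rule affine_reflection_conjugate[OF less.prems(1) a])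
      finally show ?thesis using w(2) by (simp add: word_act_append)
    qed
    with w(1) i(1) show ?thesis by (intro exI[of _ "[i] @ w @ [i]"]) auto
  qed
qed

lemma affine_reflection_is_word:
  assumes "b \<in> affine_roots"
  shows "\<exists>w. set w \<subseteq> {0..CARD('n)} \<and> (\<forall>x. affine_reflection \<Phi> b x = word_act w x)"
proof (cases "positive_affine b")
  case True
  then show ?thesis by (rule affine_reflection_is_word_if_pos[OF assms])
next
  case False
  let ?b = "(- fst b, - snd b)"
  have "?b \<in> affine_roots" using assms minus_root by auto
  moreover have "positive_affine ?b"
    unfolding positive_affine_def
  proof
    fix j assume j: "j \<in> {0..CARD('n)}"
    then have "affine_coord b j \<le> 0" using affine_coord_sign[OF assms] False by blast
    then show "0 \<le> affine_coord ?b j" using affine_coord_opposite[OF assms j] by simp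
  qed
  ultimately show ?thesis
    using affine_reflection_is_word_if_pos[of ?b] affine_reflection_opposite[OF assms] by simp
qed

end


section \<open>The Weyl group as products of reflections\<close>

primrec reflection_product :: "(complex^'n) set \<Rightarrow> (complex^'n) list \<Rightarrow> complex^'n \<Rightarrow> complex^'n" where
  "reflection_product \<Phi> [] x = x"
| "reflection_product \<Phi> (\<beta> # l) x = reflection \<Phi> \<beta> (reflection_product \<Phi> l x)"

lemma reflection_product_append:
  "reflection_product \<Phi> (k @ l) x = reflection_product \<Phi> k (reflection_product \<Phi> l x)"
  by (induction k) auto

lemma reflection_linear:
  "reflection \<Phi> \<beta> (x + y) = reflection \<Phi> \<beta> x + reflection \<Phi> \<beta> y"
  "reflection \<Phi> \<beta> (x - y) = reflection \<Phi> \<beta> x - reflection \<Phi> \<beta> y"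
  "reflection \<Phi> \<beta> (c *s x) = c *s reflection \<Phi> \<beta> x"
  "reflection \<Phi> \<beta> 0 = 0"
  by (simp_all add: reflection_def pairing_simps vec_eq_iff algebra_simps)

lemma reflection_product_linear:
  "reflection_product \<Phi> l (x + y) = reflection_product \<Phi> l x + reflection_product \<Phi> l y"
  "reflection_product \<Phi> l (x - y) = reflection_product \<Phi> l x - reflection_product \<Phi> l y"
  "reflection_product \<Phi> l (c *s x) = c *s reflection_product \<Phi> l x"
  "reflection_product \<Phi> l 0 = 0"
  by (induction l) (simp_all add: reflection_linear)

context root_sys
begin

lemma reflection_product_rev_cancel:
  assumes "set l \<subseteq> \<Phi>"
  shows "reflection_product \<Phi> l (reflection_product \<Phi> (rev l) x) = x"
    and "reflection_product \<Phi> (rev l) (reflection_product \<Phi> l x) = x"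
  using assms by (induction l arbitrary: x) (auto simp: reflection_product_append)

lemma bij_reflection_product: "set l \<subseteq> \<Phi> \<Longrightarrow> bij (reflection_product \<Phi> l)"
  by (rule o_bij[of "reflection_product \<Phi> (rev l)"])
    (auto simp: fun_eq_iff reflection_product_rev_cancel)

lemma inv_reflection_product:
  "set l \<subseteq> \<Phi> \<Longrightarrow> inv (reflection_product \<Phi> l) = reflection_product \<Phi> (rev l)"
  by (rule inv_unique_comp) (auto simp: fun_eq_iff reflection_product_rev_cancel)

lemma reflection_product_in_BijGroup: "set l \<subseteq> \<Phi> \<Longrightarrow> reflection_product \<Phi> l \<in> carrier (BijGroup UNIV)"
  using bij_reflection_product by (auto simp: BijGroup_def Bij_def)

lemma reflection_eq_product: "reflection \<Phi> \<beta> = reflection_product \<Phi> [\<beta>]"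
  by (auto simp: fun_eq_iff)

lemma BijGroup_mult_reflection_product:
  assumes "set k \<subseteq> \<Phi>" "set l \<subseteq> \<Phi>"
  shows "reflection_product \<Phi> k \<otimes>\<^bsub>BijGroup UNIV\<^esub> reflection_product \<Phi> l = reflection_product \<Phi> (k @ l)"
  using reflection_product_in_BijGroup[OF assms(1)] reflection_product_in_BijGroup[OF assms(2)]
  by (auto simp: BijGroup_def compose_def fun_eq_iff reflection_product_append)

lemma BijGroup_inv_reflection_product:
  assumes "set l \<subseteq> \<Phi>"
  shows "m_inv (BijGroup UNIV) (reflection_product \<Phi> l) = reflection_product \<Phi> (rev l)"
proof (rule group.inv_equality[OF group_BijGroup])
  have "reflection_product \<Phi> (rev l @ l) = \<one>\<^bsub>BijGroup UNIV\<^esub>"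
    using assms by (simp add: BijGroup_def fun_eq_iff reflection_product_append reflection_product_rev_cancel)
  then show "reflection_product \<Phi> (rev l) \<otimes>\<^bsub>BijGroup UNIV\<^esub> reflection_product \<Phi> l = \<one>\<^bsub>BijGroup UNIV\<^esub>"
    using assms by (simp add: BijGroup_mult_reflection_product)
qed (use assms reflection_product_in_BijGroup in auto)

lemma generate_reflections:
  assumes "S \<subseteq> \<Phi>"
  shows "generate (BijGroup UNIV) (reflection \<Phi> ` S) = reflection_product \<Phi> ` {l. set l \<subseteq> S}"
proof
  show "generate (BijGroup UNIV) (reflection \<Phi> ` S) \<subseteq> reflection_product \<Phi> ` {l. set l \<subseteq> S}"
  proof
    fix g assume "g \<in> generate (BijGroup UNIV) (reflection \<Phi> ` S)"
    then show "g \<in> reflection_product \<Phi> ` {l. set l \<subseteq> S}"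
    proof induction
      case one
      have "\<one>\<^bsub>BijGroup UNIV\<^esub> = reflection_product \<Phi> []"
        by (simp add: BijGroup_def fun_eq_iff)
      then show ?case by (intro image_eqI[of _ _ "[]"]) simp_all
    next
      case (incl h)
      then obtain \<beta> where \<beta>: "\<beta> \<in> S" "h = reflection_product \<Phi> [\<beta>]"
        using reflection_eq_product by auto
      then show ?case by (intro image_eqI[of _ _ "[\<beta>]"]) simp_all
    next
      case (inv h)
      then obtain \<beta> where \<beta>: "\<beta> \<in> S" "h = reflection_product \<Phi> [\<beta>]"
        using reflection_eq_product by auto
      with assms have "m_inv (BijGroup UNIV) h = reflection_product \<Phi> [\<beta>]"
        using BijGroup_inv_reflection_product[of "[\<beta>]"] by auto
      with \<beta>(1) show ?case by (intro image_eqI[of _ _ "[\<beta>]"]) simp_all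
    next
      case (eng g h)
      then obtain k l where kl: "g = reflection_product \<Phi> k" "set k \<subseteq> S" "h = reflection_product \<Phi> l" "set l \<subseteq> S"
        by blast
      with assms show ?case
        by (intro image_eqI[of _ _ "k @ l"]) (auto simp: BijGroup_mult_reflection_product)
    qed
  qed
  have "reflection_product \<Phi> l \<in> generate (BijGroup UNIV) (reflection \<Phi> ` S)" if "set l \<subseteq> S" for l
    using that
  proof (induction l)
    case Nil
    have "\<one>\<^bsub>BijGroup UNIV\<^esub> = reflection_product \<Phi> []"
      by (simp add: BijGroup_def fun_eq_iff)
    then show ?case using generate.one by metis
  next
    case (Cons \<beta> l)
    then have "reflection_product \<Phi> (\<beta> # l) = reflection_product \<Phi> [\<beta>] \<otimes>\<^bsub>BijGroup UNIV\<^esub> reflection_product \<Phi> l"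
      using assms by (subst BijGroup_mult_reflection_product) auto
    moreover have "reflection_product \<Phi> [\<beta>] \<in> generate (BijGroup UNIV) (reflection \<Phi> ` S)"
      using Cons.prems by (auto simp flip: reflection_eq_product intro: generate.incl)
    ultimately show ?case using Cons generate.eng by fastforce
  qed
  then show "reflection_product \<Phi> ` {l. set l \<subseteq> S} \<subseteq> generate (BijGroup UNIV) (reflection \<Phi> ` S)"
    by blast
qed

lemma reflections_in_BijGroup: "reflection \<Phi> ` \<Phi> \<subseteq> carrier (BijGroup UNIV)"
  using reflection_product_in_BijGroup by (auto simp: reflection_eq_product)

lemma carrier_weyl_group: "carrier (weyl_group \<Phi>) = reflection_product \<Phi> ` {l. set l \<subseteq> \<Phi>}"
  using reflections_in_BijGroup generate_reflections[of \<Phi>]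
  by (simp add: weyl_group_def carrier_subgroup_generated Int_absorb1)

lemma weyl_group_mult:
  "set k \<subseteq> \<Phi> \<Longrightarrow> set l \<subseteq> \<Phi> \<Longrightarrow>
    reflection_product \<Phi> k \<otimes>\<^bsub>weyl_group \<Phi>\<^esub> reflection_product \<Phi> l = reflection_product \<Phi> (k @ l)"
  by (simp add: weyl_group_def BijGroup_mult_reflection_product)

lemma weyl_group_inv:
  assumes "set l \<subseteq> \<Phi>"
  shows "m_inv (weyl_group \<Phi>) (reflection_product \<Phi> l) = reflection_product \<Phi> (rev l)"
  unfolding weyl_group_def
  by (subst group.inv_subgroup_generated[OF group_BijGroup])
    (use assms carrier_weyl_group in \<open>auto simp: weyl_group_def BijGroup_inv_reflection_product\<close>)

lemma generate_weyl_group: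
  assumes "S \<subseteq> \<Phi>"
  shows "generate (weyl_group \<Phi>) (reflection \<Phi> ` S) = reflection_product \<Phi> ` {l. set l \<subseteq> S}"
proof -
  let ?H = "generate (BijGroup UNIV) (reflection \<Phi> ` \<Phi>)"
  have "weyl_group \<Phi> = BijGroup UNIV \<lparr>carrier := ?H\<rparr>"
    using reflections_in_BijGroup by (simp add: weyl_group_def subgroup_generated_def Int_absorb1)
  moreover have "reflection \<Phi> ` S \<subseteq> ?H"
    using assms by (auto intro: generate.incl)
  ultimately have "generate (weyl_group \<Phi>) (reflection \<Phi> ` S) = generate (BijGroup UNIV) (reflection \<Phi> ` S)"
    using group.generate_consistent[OF group_BijGroup]
      group.generate_is_subgroup[OF group_BijGroup reflections_in_BijGroup] by metis
  then show ?thesis by (simp add: generate_reflections[OF assms])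
qed

lemma pairing_reflection_product:
  assumes "set l \<subseteq> \<Phi>" "\<beta> \<in> \<Phi>"
  shows "\<exists>\<gamma>\<in>\<Phi>. \<forall>x. pairing \<beta> (reflection_product \<Phi> l x) = pairing \<gamma> x"
  using assms
proof (induction l arbitrary: \<beta>)
  case (Cons \<alpha> l)
  then have "root_reflection \<Phi> \<alpha> \<beta> \<in> \<Phi>" by (simp add: root_reflection_in_roots)
  with Cons show ?case by (auto simp flip: pairing_root_reflection)
qed auto

lemma pairing_dual_act:
  assumes "set l \<subseteq> \<Phi>"
  shows "pairing (dual_act (reflection_product \<Phi> l) \<beta>) x = pairing \<beta> (reflection_product \<Phi> (rev l) x)"
proof -
  have "reflection_product \<Phi> (rev l) x = reflection_product \<Phi> (rev l) (\<Sum>i\<in>UNIV. x $ i *s axis i 1)"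
    by (simp add: basis_expansion)
  also have "\<dots> = (\<Sum>i\<in>UNIV. x $ i *s reflection_product \<Phi> (rev l) (axis i 1))"
  proof -
    have "reflection_product \<Phi> (rev l) (sum f A) = (\<Sum>i\<in>A. reflection_product \<Phi> (rev l) (f i))" for f and A :: "'n set"
      by (induction A rule: infinite_finite_induct) (simp_all add: reflection_product_linear)
    then show ?thesis by (simp add: reflection_product_linear)
  qed
  finally show ?thesis
    by (simp add: dual_act_def inv_reflection_product[OF assms] pairing_sum_right pairing_scale_right)
      (simp add: pairing_def mult.commute)
qed

lemma dual_act_in_roots:
  assumes "set l \<subseteq> \<Phi>" "\<beta> \<in> \<Phi>"
  shows "dual_act (reflection_product \<Phi> l) \<beta> \<in> \<Phi>"
proof -
  have "set (rev l) \<subseteq> \<Phi>" using assms by simp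
  from pairing_reflection_product[OF this assms(2)] obtain \<gamma> where "\<gamma> \<in> \<Phi>"
    "\<forall>x. pairing \<beta> (reflection_product \<Phi> (rev l) x) = pairing \<gamma> x" by blast
  moreover from this have "dual_act (reflection_product \<Phi> l) \<beta> = \<gamma>"
    by (intro form_eqI) (simp add: pairing_dual_act[OF assms(1)])
  ultimately show ?thesis by simp
qed

end


section \<open>The coroot lattice and the torus\<close>

lemma exp_2pi_i_eq_1_iff: "exp (2 * of_real pi * \<i> * z) = 1 \<longleftrightarrow> z \<in> \<int>"
proof
  assume "exp (2 * of_real pi * \<i> * z) = 1"
  then obtain k :: int where "Im z = 0" "Re z = of_int k"
    by (auto simp: exp_eq_1)
  then have "z = of_int k" by (simp add: complex_eq_iff)
  then show "z \<in> \<int>" by simp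
next
  assume "z \<in> \<int>"
  then obtain k :: int where "z = of_int k" by (elim Ints_cases)
  then show "exp (2 * of_real pi * \<i> * z) = 1" by (auto simp: exp_eq_1)
qed

context root_sys
begin

lemma coroot_lattice_rel: "x - y \<in> coroot_lattice \<Phi> \<longleftrightarrow> (x, y) \<in> lattice_rel \<Phi>"
  by (simp add: lattice_rel_def)

lemma zero_in_lattice: "0 \<in> coroot_lattice \<Phi>"
  using equiv_lattice_rel[of \<Phi>] by (metis coroot_lattice_rel diff_self UNIV_I equiv_class_eq_iff)

lemma minus_in_lattice: "x \<in> coroot_lattice \<Phi> \<Longrightarrow> - x \<in> coroot_lattice \<Phi>"
  using equiv_lattice_rel[of \<Phi>] coroot_lattice_rel[of x 0] coroot_lattice_rel[of 0 x]
  by (simp add: equiv_def symD)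

lemma add_in_lattice:
  assumes "x \<in> coroot_lattice \<Phi>" "y \<in> coroot_lattice \<Phi>"
  shows "x + y \<in> coroot_lattice \<Phi>"
proof -
  have "(x + y, y) \<in> lattice_rel \<Phi>" "(y, 0) \<in> lattice_rel \<Phi>"
    using assms by (simp_all flip: coroot_lattice_rel)
  then have "(x + y, 0) \<in> lattice_rel \<Phi>"
    using equiv_lattice_rel[of \<Phi>] unfolding equiv_def by (meson transE)
  then show ?thesis by (simp flip: coroot_lattice_rel)
qed

lemma diff_in_lattice:
  "x \<in> coroot_lattice \<Phi> \<Longrightarrow> y \<in> coroot_lattice \<Phi> \<Longrightarrow> x - y \<in> coroot_lattice \<Phi>"
  using add_in_lattice[of x "- y"] minus_in_lattice[of y] by simp

lemma multiple_coroot_in_lattice: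
  assumes "\<beta> \<in> \<Phi>"
  shows "of_int m *s coroot \<Phi> \<beta> \<in> coroot_lattice \<Phi>"
proof -
  have "(\<Sum>\<gamma>\<in>\<Phi>. of_int (if \<gamma> = \<beta> then m else 0) *s coroot \<Phi> \<gamma>)
      = (\<Sum>\<gamma>\<in>\<Phi>. if \<gamma> = \<beta> then of_int m *s coroot \<Phi> \<beta> else 0)"
    by (intro sum.cong) auto
  also have "\<dots> = of_int m *s coroot \<Phi> \<beta>"
    using assms finite_roots by simp
  finally show ?thesis unfolding coroot_lattice_def
    by (intro CollectI exI[of _ "\<lambda>\<gamma>. if \<gamma> = \<beta> then m else 0"]) simp
qed

text \<open>
  Closure under negation is automatic, because the negative of a coroot is again a coroot.
\<close>

lemma coroot_lattice_subset:
  assumes zero: "0 \<in> M" and add: "\<And>x y. x \<in> M \<Longrightarrow> y \<in> M \<Longrightarrow> x + y \<in> M"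
    and coroots: "\<And>\<beta>. \<beta> \<in> \<Phi> \<Longrightarrow> coroot \<Phi> \<beta> \<in> M"
  shows "coroot_lattice \<Phi> \<subseteq> M"
proof
  have nat: "of_nat m *s coroot \<Phi> \<beta> \<in> M" if "\<beta> \<in> \<Phi>" for m \<beta>
    by (induction m) (use zero add coroots that in \<open>auto simp: vec.scale_left_distrib\<close>)
  have int: "of_int m *s coroot \<Phi> \<beta> \<in> M" if \<beta>: "\<beta> \<in> \<Phi>" for m \<beta>
  proof (cases "m \<ge> 0")
    case True
    then show ?thesis using nat[OF \<beta>, of "nat m"] by simp
  next
    case False
    then show ?thesis using nat[OF minus_root[OF \<beta>], of "nat (- m)"]
      by (simp add: coroot_minus[OF \<beta>])
  qed
  fix x assume "x \<in> coroot_lattice \<Phi>"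
  then obtain k :: "complex^'n \<Rightarrow> int" where x: "x = (\<Sum>\<beta>\<in>\<Phi>. of_int (k \<beta>) *s coroot \<Phi> \<beta>)"
    by (auto simp: coroot_lattice_def)
  have "(\<Sum>\<beta>\<in>S. of_int (k \<beta>) *s coroot \<Phi> \<beta>) \<in> M" if "S \<subseteq> \<Phi>" for S
    using finite_subset[OF that finite_roots] that
    by (induction S rule: finite_induct) (use zero add int in auto)
  then show "x \<in> M" by (simp add: x)
qed

lemma pairing_lattice_Ints:
  assumes "\<beta> \<in> \<Phi>" "x \<in> coroot_lattice \<Phi>"
  shows "pairing \<beta> x \<in> \<int>"
proof -
  have "coroot_lattice \<Phi> \<subseteq> {x. pairing \<beta> x \<in> \<int>}"
    by (rule coroot_lattice_subset) (use assms(1) in \<open>auto simp: pairing_add_right cartan_int\<close>)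
  with assms(2) show ?thesis by auto
qed

lemma reflection_product_lattice:
  assumes "set l \<subseteq> \<Phi>" "x \<in> coroot_lattice \<Phi>"
  shows "reflection_product \<Phi> l x \<in> coroot_lattice \<Phi>"
  using assms
proof (induction l)
  case (Cons \<beta> l)
  let ?x = "reflection_product \<Phi> l x"
  have x: "?x \<in> coroot_lattice \<Phi>" and \<beta>: "\<beta> \<in> \<Phi>" using Cons by auto
  then obtain m where "pairing \<beta> ?x = of_int m"
    using pairing_lattice_Ints by (metis Ints_cases)
  then show ?case
    using diff_in_lattice[OF x multiple_coroot_in_lattice[OF \<beta>, of m]] by (simp add: reflection_def)
qed simp

lemma torus_proj_eq: "torus_proj \<Phi> x = {y. x - y \<in> coroot_lattice \<Phi>}"
  by (auto simp: torus_proj_def lattice_rel_def)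

lemma torus_proj_eq_iff: "torus_proj \<Phi> x = torus_proj \<Phi> y \<longleftrightarrow> x - y \<in> coroot_lattice \<Phi>"
  unfolding torus_proj_def coroot_lattice_rel
  using equiv_lattice_rel[of \<Phi>] by (simp add: eq_equiv_class_iff)

lemma torus_eq: "torus \<Phi> = range (torus_proj \<Phi>)"
  by (auto simp: torus_proj_def torus_def quotient_def)

lemma torus_act_proj:
  assumes "set l \<subseteq> \<Phi>"
  shows "torus_act (reflection_product \<Phi> l) (torus_proj \<Phi> x) = torus_proj \<Phi> (reflection_product \<Phi> l x)"
proof -
  have "y \<in> reflection_product \<Phi> l ` torus_proj \<Phi> x" if y: "reflection_product \<Phi> l x - y \<in> coroot_lattice \<Phi>" for y
  proof (rule image_eqI)
    show "y = reflection_product \<Phi> l (reflection_product \<Phi> (rev l) y)"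
      by (simp add: reflection_product_rev_cancel[OF assms])
    have "reflection_product \<Phi> (rev l) (reflection_product \<Phi> l x - y) \<in> coroot_lattice \<Phi>"
      using assms y by (intro reflection_product_lattice) auto
    then show "reflection_product \<Phi> (rev l) y \<in> torus_proj \<Phi> x"
      by (simp add: torus_proj_eq reflection_product_linear reflection_product_rev_cancel[OF assms])
  qed
  moreover have "reflection_product \<Phi> l x - reflection_product \<Phi> l y \<in> coroot_lattice \<Phi>"
    if "x - y \<in> coroot_lattice \<Phi>" for y
    using reflection_product_lattice[OF assms that] by (simp add: reflection_product_linear)
  ultimately show ?thesis
    unfolding torus_act_def by (auto simp: torus_proj_eq)
qed

lemma character_proj:
  assumes "\<beta> \<in> \<Phi>"
  shows "character \<beta> (torus_proj \<Phi> x) = 1 \<longleftrightarrow> pairing \<beta> x \<in> \<int>"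
proof -
  let ?e = "\<lambda>x. exp (2 * of_real pi * \<i> * pairing \<beta> x)"
  have "?e y = ?e x" if "y \<in> torus_proj \<Phi> x" for y
  proof -
    have "pairing \<beta> (x - y) \<in> \<int>"
      using that assms by (simp add: torus_proj_eq pairing_lattice_Ints)
    then have "exp (2 * of_real pi * \<i> * pairing \<beta> (x - y)) = 1"
      by (simp only: exp_2pi_i_eq_1_iff)
    then have "?e x = ?e y * 1"
      by (subst (asm) pairing_diff_right) (simp add: right_diff_distrib exp_diff)
    then show ?thesis by simp
  qed
  moreover have "x \<in> torus_proj \<Phi> x" by (simp add: torus_proj_eq zero_in_lattice)
  ultimately have "?e ` torus_proj \<Phi> x = {?e x}" by blast
  then show ?thesis by (simp add: character_def exp_2pi_i_eq_1_iff)
qed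

lemma point_system_proj: "point_system \<Phi> (torus_proj \<Phi> x) = {\<beta> \<in> \<Phi>. pairing \<beta> x \<in> \<int>}"
  by (auto simp: point_system_def character_proj)

lemma point_system_torus_act:
  assumes l: "set l \<subseteq> \<Phi>" and t: "t \<in> torus \<Phi>"
  shows "point_system \<Phi> (torus_act (reflection_product \<Phi> l) t)
    = dual_act (reflection_product \<Phi> l) ` point_system \<Phi> t"
proof -
  obtain x where x: "t = torus_proj \<Phi> x" using t by (auto simp: torus_eq)
  let ?d = "dual_act (reflection_product \<Phi> l)" and ?d' = "dual_act (reflection_product \<Phi> (rev l))"
  have l': "set (rev l) \<subseteq> \<Phi>" using l by simp
  have "\<beta> \<in> ?d ` {\<beta> \<in> \<Phi>. pairing \<beta> x \<in> \<int>}" if "\<beta> \<in> \<Phi>" "pairing \<beta> (reflection_product \<Phi> l x) \<in> \<int>" for \<beta>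
  proof (rule image_eqI)
    show "\<beta> = ?d (?d' \<beta>)"
      by (rule form_eqI) (simp add: pairing_dual_act[OF l] pairing_dual_act[OF l'] reflection_product_rev_cancel[OF l])
    show "?d' \<beta> \<in> {\<beta> \<in> \<Phi>. pairing \<beta> x \<in> \<int>}"
      using that dual_act_in_roots[OF l'] by (simp add: pairing_dual_act[OF l'])
  qed
  moreover have "?d \<beta> \<in> \<Phi> \<and> pairing (?d \<beta>) (reflection_product \<Phi> l x) \<in> \<int>"
    if "\<beta> \<in> \<Phi>" "pairing \<beta> x \<in> \<int>" for \<beta>
    using that dual_act_in_roots[OF l] by (simp add: pairing_dual_act[OF l] reflection_product_rev_cancel[OF l])
  ultimately show ?thesis
    unfolding x torus_act_proj[OF l] point_system_proj by auto
qed

end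

context based_root_sys
begin

text \<open>
  The maps given by words are exactly the elements of the affine Weyl group, the semidirect
  product of the Weyl group with the translations by the coroot lattice: this lemma decomposes a
  word, and \<open>affine_weyl_element_is_word\<close> below is the converse.  Thus the orbits and stabilizers
  of the Weyl group on the torus can be read off from words acting on the Cartan subalgebra.
\<close>

lemma word_act_linear_part:
  assumes "set w \<subseteq> {0..CARD('n)}"
  shows "\<exists>\<tau>\<in>coroot_lattice \<Phi>. \<forall>x. word_act w x = reflection_product \<Phi> (map \<alpha> w) x + \<tau>"
  using assms
proof (induction w)
  case Nil
  then show ?case using zero_in_lattice by (intro bexI[of _ 0]) auto
next
  case (Cons i w)
  then obtain \<mu> where \<mu>: "\<mu> \<in> coroot_lattice \<Phi>"
    "\<forall>x. word_act w x = reflection_product \<Phi> (map \<alpha> w) x + \<mu>" by auto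
  have i: "\<alpha> i \<in> \<Phi>" using Cons.prems alpha_root by simp
  let ?c = "of_int (snd (simple_affine i)) *s coroot \<Phi> (\<alpha> i)"
  have "reflection \<Phi> (\<alpha> i) \<mu> - ?c \<in> coroot_lattice \<Phi>"
    using reflection_product_lattice[of "[\<alpha> i]"] i \<mu>(1)
    by (intro diff_in_lattice multiple_coroot_in_lattice) auto
  moreover have "word_act (i # w) x = reflection_product \<Phi> (map \<alpha> (i # w)) x + (reflection \<Phi> (\<alpha> i) \<mu> - ?c)" for x
    by (simp add: \<mu>(2) affine_reflection_def affine_value_def reflection_def pairing_simps vec_eq_iff algebra_simps)
  ultimately show ?case by blast
qed

lemma translation_is_word:
  assumes "\<tau> \<in> coroot_lattice \<Phi>"
  shows "\<exists>w. set w \<subseteq> {0..CARD('n)} \<and> (\<forall>x. x + \<tau> = word_act w x)"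
proof -
  let ?M = "{\<tau>. \<exists>w. set w \<subseteq> {0..CARD('n)} \<and> (\<forall>x. x + \<tau> = word_act w x)}"
  have "coroot_lattice \<Phi> \<subseteq> ?M"
  proof (rule coroot_lattice_subset)
    show "0 \<in> ?M" by (auto intro: exI[of _ "[]"])
    fix x y assume "x \<in> ?M" "y \<in> ?M"
    then obtain u v where "set u \<subseteq> {0..CARD('n)}" "set v \<subseteq> {0..CARD('n)}"
      "\<forall>z. z + x = word_act u z" "\<forall>z. z + y = word_act v z" by blast
    moreover from this have "z + (x + y) = word_act (v @ u) z" for z
      by (metis word_act_append add.assoc)
    ultimately show "x + y \<in> ?M" by (intro CollectI exI[of _ "v @ u"]) auto
  next
    fix \<beta> assume \<beta>: "\<beta> \<in> \<Phi>"
    \<comment> \<open>The reflections in the parallel hyperplanes \<open>\<beta> = 0\<close> and \<open>\<beta> = 1\<close> compose to a translation.\<close>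
    obtain u v where uv: "set u \<subseteq> {0..CARD('n)}" "set v \<subseteq> {0..CARD('n)}"
      "\<forall>x. affine_reflection \<Phi> (\<beta>, -1) x = word_act u x"
      "\<forall>x. affine_reflection \<Phi> (\<beta>, 0) x = word_act v x"
      using affine_reflection_is_word[of "(\<beta>, -1)"] affine_reflection_is_word[of "(\<beta>, 0)"] \<beta> by auto
    have "x + coroot \<Phi> \<beta> = word_act (u @ v) x" for x
      unfolding word_act_append uv(3,4)[rule_format, symmetric]
      using \<beta> by (simp add: affine_reflection_def affine_value_def pairing_simps vec_eq_iff algebra_simps)
    with uv show "coroot \<Phi> \<beta> \<in> ?M" by (intro CollectI exI[of _ "u @ v"]) auto
  qed
  with assms show ?thesis by blast
qed

lemma affine_weyl_element_is_word:
  assumes "set l \<subseteq> \<Phi>" "\<tau> \<in> coroot_lattice \<Phi>"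
  shows "\<exists>w. set w \<subseteq> {0..CARD('n)} \<and> (\<forall>x. reflection_product \<Phi> l x + \<tau> = word_act w x)"
proof -
  have "\<exists>w. set w \<subseteq> {0..CARD('n)} \<and> (\<forall>x. reflection_product \<Phi> l x = word_act w x)"
    using assms(1)
  proof (induction l)
    case Nil
    show ?case by (intro exI[of _ "[]"]) simp
  next
    case (Cons \<beta> l)
    then obtain v where v: "set v \<subseteq> {0..CARD('n)}" "\<forall>x. reflection_product \<Phi> l x = word_act v x" by auto
    from Cons.prems obtain u where u: "set u \<subseteq> {0..CARD('n)}" "\<forall>x. affine_reflection \<Phi> (\<beta>, 0) x = word_act u x"
      using affine_reflection_is_word[of "(\<beta>, 0)"] by auto
    have "affine_reflection \<Phi> (\<beta>, 0) x = reflection \<Phi> \<beta> x" for x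
      by (simp add: affine_reflection_def affine_value_def reflection_def)
    with u(2) have "reflection \<Phi> \<beta> x = word_act u x" for x by simp
    with u(1) v show ?case by (intro exI[of _ "u @ v"]) (auto simp: word_act_append)
  qed
  then obtain v where v: "set v \<subseteq> {0..CARD('n)}" "\<forall>x. reflection_product \<Phi> l x = word_act v x" by blast
  obtain u where u: "set u \<subseteq> {0..CARD('n)}" "\<forall>x. x + \<tau> = word_act u x"
    using translation_is_word[OF assms(2)] by blast
  show ?thesis
    by (intro exI[of _ "u @ v"]) (use u v in \<open>auto simp: word_act_append\<close>)
qed

end


section \<open>The zero-dimensional layers\<close>

lemma small_Ints_eq_0: "norm z < 1 \<Longrightarrow> z \<in> \<int> \<Longrightarrow> z = (0 :: complex)"
  by (auto elim!: Ints_cases)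

context based_root_sys
begin

lemma topspace_torus: "topspace (torus_topology \<Phi>) = torus \<Phi>"
  using quotient_imp_surjective_map[OF quotient_map_torus_proj[of \<Phi>]] by (simp add: torus_eq)

text \<open>
  The preimage of the image of \<open>U\<close> is the union of the translates of \<open>U\<close> by the lattice.
\<close>

lemma open_torus_proj_image:
  assumes "open U"
  shows "openin (torus_topology \<Phi>) (torus_proj \<Phi> ` U)"
proof -
  have "\<Union>(torus_proj \<Phi> ` U) = (\<Union>q\<in>coroot_lattice \<Phi>. (+) q ` U)"
  proof (intro equalityI subsetI)
    fix y assume "y \<in> \<Union>(torus_proj \<Phi> ` U)"
    then obtain x where x: "x \<in> U" "x - y \<in> coroot_lattice \<Phi>" by (auto simp: torus_proj_eq)
    then have "y - x \<in> coroot_lattice \<Phi>" using minus_in_lattice by fastforce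
    then show "y \<in> (\<Union>q\<in>coroot_lattice \<Phi>. (+) q ` U)"
      using x(1) by (intro UN_I[of "y - x"] image_eqI[of _ _ x]) auto
  next
    fix y assume "y \<in> (\<Union>q\<in>coroot_lattice \<Phi>. (+) q ` U)"
    then obtain q x where "q \<in> coroot_lattice \<Phi>" "x \<in> U" "y = q + x" by auto
    moreover from this have "y \<in> torus_proj \<Phi> x"
      using minus_in_lattice by (simp add: torus_proj_eq)
    ultimately show "y \<in> \<Union>(torus_proj \<Phi> ` U)" by blast
  qed
  moreover have "open (\<Union>q\<in>coroot_lattice \<Phi>. (+) q ` U)"
    using assms open_translation by blast
  ultimately show ?thesis by (auto simp: openin_torus_topology torus_eq)
qed

lemma positive_or_negative: "\<beta> \<in> \<Phi> \<Longrightarrow> \<beta> \<in> positive_roots \<Phi> \<alpha> \<or> - \<beta> \<in> positive_roots \<Phi> \<alpha>"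
  using simple_roots minus_root by (auto simp: positive_roots_def simple_roots_def)

text \<open>
  Integer-valued linear functions that differ by less than \<open>1\<close> agree, so when the roots in
  \<open>B\<close> span, the intersection of their hypersurfaces is discrete.
\<close>

lemma discrete_intersection:
  assumes B: "B \<subseteq> positive_roots \<Phi> \<alpha>" "vec.span B = UNIV"
  shows "subtopology (torus_topology \<Phi>) (\<Inter>(hypersurface \<Phi> ` B))
    = discrete_topology (torus \<Phi> \<inter> \<Inter>(hypersurface \<Phi> ` B))"
proof (rule sym, unfold discrete_topology_unique, intro conjI ballI)
  show "topspace (subtopology (torus_topology \<Phi>) (\<Inter>(hypersurface \<Phi> ` B)))
      = torus \<Phi> \<inter> \<Inter>(hypersurface \<Phi> ` B)"
    by (simp add: topspace_torus)
next
  fix t assume t: "t \<in> torus \<Phi> \<inter> \<Inter>(hypersurface \<Phi> ` B)"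
  then obtain z where z: "t = torus_proj \<Phi> z" by (auto simp: torus_eq)
  have B\<Phi>: "B \<subseteq> \<Phi>" using B by (auto simp: positive_roots_def)
  have int: "pairing \<beta> y \<in> \<int>" if "\<beta> \<in> B" "torus_proj \<Phi> y \<in> \<Inter>(hypersurface \<Phi> ` B)" for \<beta> y
  proof -
    have "character \<beta> (torus_proj \<Phi> y) = 1" using that by (auto simp: hypersurface_def)
    then show ?thesis using character_proj that(1) B\<Phi> by blast
  qed
  let ?U = "\<Inter>\<beta>\<in>B. {y. norm (pairing \<beta> (y - z)) < 1}"
  have "open ?U"
  proof (rule open_INT)
    show "finite B" using B\<Phi> finite_roots finite_subset by blast
    show "\<forall>\<beta>\<in>B. open {y. norm (pairing \<beta> (y - z)) < 1}"
      by (intro ballI open_Collect_less continuous_intros)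
  qed
  moreover have "torus_proj \<Phi> ` ?U \<inter> \<Inter>(hypersurface \<Phi> ` B) = {t}"
  proof (intro equalityI subsetI)
    fix s assume s: "s \<in> torus_proj \<Phi> ` ?U \<inter> \<Inter>(hypersurface \<Phi> ` B)"
    then obtain y where y: "s = torus_proj \<Phi> y" "y \<in> ?U" by blast
    have "pairing \<beta> y = pairing \<beta> z" if \<beta>: "\<beta> \<in> B" for \<beta>
    proof -
      have "torus_proj \<Phi> y \<in> \<Inter>(hypersurface \<Phi> ` B)" "torus_proj \<Phi> z \<in> \<Inter>(hypersurface \<Phi> ` B)"
        using s t unfolding y(1) z by simp_all
      then have "pairing \<beta> y \<in> \<int>" "pairing \<beta> z \<in> \<int>" using int[OF \<beta>] by simp_all
      then have "pairing \<beta> (y - z) \<in> \<int>" by (simp add: pairing_diff_right)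
      moreover have "norm (pairing \<beta> (y - z)) < 1" using y(2) \<beta> by blast
      ultimately have "pairing \<beta> (y - z) = 0" by (intro small_Ints_eq_0)
      then show ?thesis by (simp add: pairing_diff_right)
    qed
    then have "y = z" by (rule eq_if_pairing_eq_on_spanning[OF B(2)])
    with y z show "s \<in> {t}" by simp
  next
    fix s assume "s \<in> {t}"
    then show "s \<in> torus_proj \<Phi> ` ?U \<inter> \<Inter>(hypersurface \<Phi> ` B)" using t z by auto
  qed
  ultimately show "openin (subtopology (torus_topology \<Phi>) (\<Inter>(hypersurface \<Phi> ` B))) {t}"
    unfolding openin_subtopology by (intro exI[of _ "torus_proj \<Phi> ` ?U"] conjI open_torus_proj_image) simp_all
qed

text \<open>
  The line through \<open>x\<close> in direction \<open>u\<close> stays in the intersection.  Its image in the torus is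
  connected, and it is not a single point because the roots are integral on the lattice.
\<close>

lemma layer_not_singleton:
  assumes B: "B \<subseteq> positive_roots \<Phi> \<alpha>" and x: "torus_proj \<Phi> x \<in> \<Inter>(hypersurface \<Phi> ` B)"
    and u: "u \<noteq> 0" "\<And>\<beta>. \<beta> \<in> B \<Longrightarrow> pairing \<beta> u = 0"
  shows "{torus_proj \<Phi> x} \<notin> connected_components_of (subtopology (torus_topology \<Phi>) (\<Inter>(hypersurface \<Phi> ` B)))"
proof
  assume comp: "{torus_proj \<Phi> x} \<in> connected_components_of (subtopology (torus_topology \<Phi>) (\<Inter>(hypersurface \<Phi> ` B)))"
  let ?f = "\<lambda>s::real. torus_proj \<Phi> (x + of_real s *s u)"
  have "continuous_map euclideanreal euclidean (\<lambda>s::real. x + of_real s *s u)"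
    by (auto simp: vector_scalar_mult_def intro!: continuous_intros)
  from continuous_map_compose[OF this quotient_imp_continuous_map[OF quotient_map_torus_proj[of \<Phi>]]]
  have "continuous_map euclideanreal (torus_topology \<Phi>) ?f" by (simp add: comp_def)
  then have "connectedin (torus_topology \<Phi>) (range ?f)"
    by (rule connectedin_continuous_map_image) simp
  moreover have "range ?f \<subseteq> \<Inter>(hypersurface \<Phi> ` B)"
  proof -
    have "?f s \<in> hypersurface \<Phi> \<beta>" if \<beta>: "\<beta> \<in> B" for s \<beta>
    proof -
      have \<beta>\<Phi>: "\<beta> \<in> \<Phi>" using \<beta> B by (auto simp: positive_roots_def)
      have "character \<beta> (torus_proj \<Phi> x) = 1" using x \<beta> by (auto simp: hypersurface_def)
      then have "pairing \<beta> (x + of_real s *s u) \<in> \<int>"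
        using u(2)[OF \<beta>] \<beta>\<Phi> by (simp add: character_proj pairing_add_right pairing_scale_right)
      with \<beta>\<Phi> show ?thesis by (simp add: hypersurface_def character_proj torus_eq)
    qed
    then show ?thesis by blast
  qed
  ultimately have "connectedin (subtopology (torus_topology \<Phi>) (\<Inter>(hypersurface \<Phi> ` B))) (range ?f)"
    by (simp add: connectedin_subtopology)
  moreover have "torus_proj \<Phi> x \<in> range ?f" by (rule range_eqI[of _ _ 0]) simp
  ultimately have "range ?f \<subseteq> {torus_proj \<Phi> x}"
    using connected_components_of_maximal[OF comp] by (auto simp: disjnt_def)
  then have lattice: "of_real s *s u \<in> coroot_lattice \<Phi>" for s :: real
    using torus_proj_eq_iff[of "x + of_real s *s u" x] by auto
  have "pairing \<beta> u = pairing \<beta> 0" if \<beta>: "\<beta> \<in> \<Phi>" for \<beta>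
  proof (rule ccontr)
    assume "pairing \<beta> u \<noteq> pairing \<beta> 0"
    then have "norm (pairing \<beta> u) > 0" by simp
    \<comment> \<open>Scale \<open>u\<close> so that the pairing with \<open>\<beta>\<close> has absolute value \<open>1/2\<close>, which is impossible on the lattice.\<close>
    define s where "s = 1 / (2 * norm (pairing \<beta> u))"
    have "pairing \<beta> (of_real s *s u) \<in> \<int>" by (rule pairing_lattice_Ints[OF \<beta> lattice])
    moreover have "norm (pairing \<beta> (of_real s *s u)) = \<bar>s\<bar> * norm (pairing \<beta> u)"
      by (simp add: pairing_scale_right norm_mult)
    then have "norm (pairing \<beta> (of_real s *s u)) = 1 / 2"
      using \<open>norm (pairing \<beta> u) > 0\<close> by (simp add: s_def)
    ultimately show False using small_Ints_eq_0[of "pairing \<beta> (of_real s *s u)"] by auto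
  qed
  then have "u = 0" by (rule eq_if_pairing_eq_on_spanning[OF span_roots])
  with u(1) show False ..
qed

text \<open>
  A layer through \<open>t\<close> extends exactly in the directions that are killed by the roots whose
  hypersurfaces are intersected; these are some of the roots integral at \<open>t\<close>.
\<close>

theorem zero_dim_layers_eq:
  "zero_dim_layers \<Phi> \<alpha> = {t \<in> torus \<Phi>. vec.span (point_system \<Phi> t) = UNIV}"
proof (intro equalityI subsetI)
  fix t assume "t \<in> zero_dim_layers \<Phi> \<alpha>"
  then obtain L where tL: "t \<in> L" and dim: "L \<in> layers_of_dim 0 \<Phi> \<alpha>"
    unfolding zero_dim_layers_def by (rule UnionE)
  have L: "L \<in> layers \<Phi> \<alpha>"
    and "\<exists>x U. vec.subspace U \<and> vec.dim U = 0 \<and> L = torus_proj \<Phi> ` ((+) x ` U)"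
    using dim by (simp_all only: layers_of_dim_def mem_Collect_eq)
  then obtain x U where U: "vec.subspace U" "vec.dim U = 0" and Lx: "L = torus_proj \<Phi> ` ((+) x ` U)"
    by (elim exE conjE)
  have "U = {0}" using U vec.subspace_0[OF U(1)] vec.dim_eq_0[of U] by auto
  with tL Lx have t: "t = torus_proj \<Phi> x" and Lt: "L = {torus_proj \<Phi> x}" by auto
  obtain \<A> where "\<A> \<subseteq> toric_arrangement \<Phi> \<alpha>"
    and comp: "L \<in> connected_components_of (subtopology (torus_topology \<Phi>) (\<Inter>\<A>))"
    using L by (auto simp: layers_def)
  then obtain B where B: "B \<subseteq> positive_roots \<Phi> \<alpha>" "\<A> = hypersurface \<Phi> ` B"
    by (auto simp: toric_arrangement_def subset_image_iff)
  have tA: "torus_proj \<Phi> x \<in> \<Inter>(hypersurface \<Phi> ` B)"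
    using connected_components_of_subset[OF comp] by (auto simp: Lt B(2))
  have "B \<subseteq> point_system \<Phi> t"
    using tA B(1) by (auto simp: t hypersurface_def point_system_def positive_roots_def)
  moreover have "vec.span B = UNIV"
    using layer_not_singleton[OF B(1) tA] comp ex_nonzero_vector_annihilated[of B]
    unfolding Lt B(2) by blast
  ultimately have "vec.span (point_system \<Phi> t) = UNIV"
    using vec.span_mono by blast
  then show "t \<in> {t \<in> torus \<Phi>. vec.span (point_system \<Phi> t) = UNIV}" by (simp add: t torus_eq)
next
  fix t assume "t \<in> {t \<in> torus \<Phi>. vec.span (point_system \<Phi> t) = UNIV}"
  then have t: "t \<in> torus \<Phi>" and span: "vec.span (point_system \<Phi> t) = UNIV" by auto
  obtain x where x: "t = torus_proj \<Phi> x" using t by (auto simp: torus_eq)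
  define B where "B = point_system \<Phi> t \<inter> positive_roots \<Phi> \<alpha>"
  have "point_system \<Phi> t \<subseteq> vec.span B"
  proof
    fix \<beta> assume \<beta>: "\<beta> \<in> point_system \<Phi> t"
    then have "- \<beta> \<in> point_system \<Phi> t" "\<beta> \<in> \<Phi>"
      using minus_root by (auto simp: x point_system_proj)
    then have "\<beta> \<in> B \<or> - \<beta> \<in> B"
      using \<beta> positive_or_negative by (auto simp: B_def)
    then show "\<beta> \<in> vec.span B"
      using vec.span_base vec.span_neg by (metis minus_minus)
  qed
  then have "vec.span B = UNIV"
    using span vec.span_minimal[OF _ vec.subspace_span] by blast
  then have "subtopology (torus_topology \<Phi>) (\<Inter>(hypersurface \<Phi> ` B))
    = discrete_topology (torus \<Phi> \<inter> \<Inter>(hypersurface \<Phi> ` B))"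
    by (intro discrete_intersection) (auto simp: B_def)
  moreover have "t \<in> torus \<Phi> \<inter> \<Inter>(hypersurface \<Phi> ` B)"
    using t by (auto simp: B_def hypersurface_def point_system_def)
  ultimately have "{t} \<in> connected_components_of (subtopology (torus_topology \<Phi>) (\<Inter>(hypersurface \<Phi> ` B)))"
    by (simp add: connected_components_of_discrete_topology)
  moreover have "hypersurface \<Phi> ` B \<in> Pow (toric_arrangement \<Phi> \<alpha>)"
    by (auto simp: toric_arrangement_def B_def)
  ultimately have "{t} \<in> layers \<Phi> \<alpha>" unfolding layers_def by blast
  moreover have "\<exists>y U. vec.subspace U \<and> vec.dim U = 0 \<and> {t} = torus_proj \<Phi> ` ((+) y ` U)"
    by (intro exI[of _ x] exI[of _ "{0}"]) (simp add: x vec.subspace_single_0)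
  ultimately show "t \<in> zero_dim_layers \<Phi> \<alpha>"
    unfolding zero_dim_layers_def layers_of_dim_def by blast
qed

end


section \<open>The vertices of the alcove\<close>

context based_root_sys
begin

text \<open>The point at which all simple affine roots but \<open>simple_affine p\<close> vanish.\<close>

definition vertex :: "nat \<Rightarrow> complex^'n" where
  "vertex p = (1 / of_int (mark p)) *s coweight p"

lemma affine_value_vertex:
  assumes "b \<in> affine_roots" "p \<in> {0..CARD('n)}"
  shows "affine_value b (vertex p) = of_int (affine_coord b p) / of_int (mark p)"
  using mark_pos[OF assms(2)]
  by (simp add: of_int_affine_coord[OF assms] affine_value_def vertex_def pairing_scale_right field_simps)

lemma affine_value_simple_vertex:
  assumes "j \<in> {0..CARD('n)}" "p \<in> {0..CARD('n)}"
  shows "affine_value (simple_affine j) (vertex p) = (if j = p then 1 / of_int (mark p) else 0)"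
  by (simp add: affine_value_vertex[OF simple_affine_in[OF assms(1)] assms(2)] affine_coord_simple[OF assms])

lemma vertex_in_alcove: "p \<in> {0..CARD('n)} \<Longrightarrow> vertex p \<in> alcove"
  using mark_pos[of p]
  by (auto simp: alcove_def affine_value_simple_vertex less_eq_complex_def Re_divide_of_real)

lemma walls_at_vertex: "p \<in> {0..CARD('n)} \<Longrightarrow> walls_at (vertex p) = {0..CARD('n)} - {p}"
  using mark_pos[of p] by (auto simp: walls_at_def affine_value_simple_vertex)

lemma sum_marks: "(\<Sum>j\<in>{0..CARD('n)}. of_int (mark j) * affine_value (simple_affine j) x) = 1"
proof -
  have \<theta>: "- \<alpha> 0 \<in> \<Phi>" using alpha_root[of 0] minus_root by simp
  have "(\<Sum>j\<in>{1..CARD('n)}. of_int (mark j) * affine_value (simple_affine j) x)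
      = pairing (\<Sum>j\<in>{1..CARD('n)}. of_int (root_coord (- \<alpha> 0) j) *s \<alpha> j) x"
    unfolding pairing_sum_left pairing_scale_left
    by (intro sum.cong) (auto simp: mark_def affine_value_def simple_affine_def)
  also have "\<dots> = pairing (- \<alpha> 0) x"
    using root_coord_expansion[OF \<theta>] by simp
  finally show ?thesis
    by (simp add: sum.atLeast_Suc_atMost affine_value_def simple_affine_def mark_def)
qed

text \<open>
  The relation \<open>sum_marks\<close> determines the value of the one simple affine root that need not vanish
  at \<open>y\<close>.
\<close>

lemma vertex_unique:
  assumes p: "p \<in> {0..CARD('n)}" and y: "{0..CARD('n)} - {p} \<subseteq> walls_at y"
  shows "y = vertex p"
proof (rule eq_if_pairing_eq_on_spanning[OF span_roots])
  have zero: "affine_value (simple_affine j) y = 0" if "j \<in> {0..CARD('n)}" "j \<noteq> p" for j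
    using y that by (auto simp: walls_at_def)
  have one: "(\<Sum>j\<in>{0..CARD('n)}. f j * affine_value (simple_affine j) y) = f p * affine_value (simple_affine p) y" for f
  proof -
    have "(\<Sum>j\<in>{0..CARD('n)}. f j * affine_value (simple_affine j) y)
        = (\<Sum>j\<in>{0..CARD('n)}. if j = p then f p * affine_value (simple_affine p) y else 0)"
      by (intro sum.cong) (auto simp: zero)
    then show ?thesis using p by simp
  qed
  have "of_int (mark p) * affine_value (simple_affine p) y = 1"
    using sum_marks[of y] one[of "\<lambda>j. of_int (mark j)"] by simp
  then have v: "affine_value (simple_affine p) y = 1 / of_int (mark p)"
    using mark_pos[OF p] by (simp add: field_simps)
  fix \<beta> assume "\<beta> \<in> \<Phi>"
  then have b: "(\<beta>, 0) \<in> affine_roots" by simp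
  have "affine_value (\<beta>, 0) y = of_int (affine_coord (\<beta>, 0) p) / of_int (mark p)"
    unfolding affine_value_expansion[OF b] one v by simp
  then have "affine_value (\<beta>, 0) y = affine_value (\<beta>, 0) (vertex p)"
    by (simp only: affine_value_vertex[OF b p])
  then show "pairing \<beta> y = pairing \<beta> (vertex p)" by (simp add: affine_value_def)
qed

text \<open>
  At a point of the alcove all terms of the expansion of an affine root have the same sign, so they
  vanish together with their sum.
\<close>

lemma vanishing_affine_root:
  assumes b: "b \<in> affine_roots" and y: "y \<in> alcove" "affine_value b y = 0"
    and j: "j \<in> {0..CARD('n)}" "j \<notin> walls_at y"
  shows "affine_coord b j = 0"
proof -
  let ?f = "\<lambda>i. complex_of_int (affine_coord b i) * affine_value (simple_affine i) y"
  have sum: "sum ?f {0..CARD('n)} = 0"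
    using affine_value_expansion[OF b, of y] y(2) by simp
  have a: "0 \<le> affine_value (simple_affine i) y" if "i \<in> {0..CARD('n)}" for i
    using y(1) that by (simp add: alcove_def)
  have "?f j = 0"
  proof (cases "positive_affine b")
    case True
    then have "0 \<le> ?f i" if "i \<in> {0..CARD('n)}" for i
      using a[OF that] that by (intro mult_nonneg_nonneg) (simp_all add: positive_affine_def less_eq_complex_def)
    then show ?thesis using sum j(1) sum_nonneg_eq_0_iff[of "{0..CARD('n)}" ?f] by blast
  next
    case False
    then have "0 \<le> - ?f i" if "i \<in> {0..CARD('n)}" for i
      using a[OF that] that affine_coord_sign[OF b]
        mult_nonneg_nonneg[of "- complex_of_int (affine_coord b i)" "affine_value (simple_affine i) y"]
      by (simp add: less_eq_complex_def)
    moreover have "sum (\<lambda>i. - ?f i) {0..CARD('n)} = 0" using sum by (simp add: sum_negf)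
    ultimately have "- ?f j = 0" using j(1) sum_nonneg_eq_0_iff[of "{0..CARD('n)}" "\<lambda>i. - ?f i"] by blast
    then show ?thesis by simp
  qed
  moreover have "affine_value (simple_affine j) y \<noteq> 0" using j by (simp add: walls_at_def)
  ultimately show ?thesis by simp
qed

text \<open>
  A root is integral at \<open>y\<close> iff some affine root parallel to it vanishes there, so the simple affine
  roots of the walls through \<open>y\<close> have spanning linear parts and there are at least \<open>CARD('n)\<close> of them;
  by \<open>sum_marks\<close> not all \<open>CARD('n) + 1\<close> walls can meet in a point.
\<close>

lemma spanning_point_is_vertex:
  assumes y: "y \<in> alcove" and span: "vec.span (point_system \<Phi> (torus_proj \<Phi> y)) = UNIV"
  shows "\<exists>p\<in>{0..CARD('n)}. y = vertex p"
proof -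
  have sub: "walls_at y \<subseteq> {0..CARD('n)}" by (auto simp: walls_at_def)
  then have fin: "finite (walls_at y)" using finite_subset by blast
  have "point_system \<Phi> (torus_proj \<Phi> y) \<subseteq> vec.span (\<alpha> ` walls_at y)"
  proof
    fix \<beta> assume "\<beta> \<in> point_system \<Phi> (torus_proj \<Phi> y)"
    then obtain k where \<beta>: "\<beta> \<in> \<Phi>" and k: "pairing \<beta> y = of_int k"
      by (auto simp: point_system_proj elim: Ints_cases)
    let ?b = "(\<beta>, - k)"
    have b: "?b \<in> affine_roots" using \<beta> by simp
    have "affine_value ?b y = 0" by (simp add: affine_value_def k)
    then have zero: "affine_coord ?b j = 0" if "j \<in> {0..CARD('n)}" "j \<notin> walls_at y" for j
      using vanishing_affine_root[OF b y] that by blast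
    have "(\<Sum>j\<in>{0..CARD('n)}. of_int (affine_coord ?b j) *s \<alpha> j) \<in> vec.span (\<alpha> ` walls_at y)"
    proof (rule vec.span_sum)
      fix j assume j: "j \<in> {0..CARD('n)}"
      show "of_int (affine_coord ?b j) *s \<alpha> j \<in> vec.span (\<alpha> ` walls_at y)"
      proof (cases "j \<in> walls_at y")
        case True
        then show ?thesis by (intro vec.span_scale vec.span_base) simp
      next
        case False
        then show ?thesis using zero[OF j] vec.span_zero by simp
      qed
    qed
    then show "\<beta> \<in> vec.span (\<alpha> ` walls_at y)"
      using affine_coord_expansion[OF b] by simp
  qed
  then have "vec.span (\<alpha> ` walls_at y) = UNIV"
    using span vec.span_minimal[OF _ vec.subspace_span] by blast
  then have "vec.dim (UNIV :: (complex^'n) set) \<le> card (\<alpha> ` walls_at y)"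
    using fin by (intro vec.dim_le_card) auto
  then have "CARD('n) \<le> card (walls_at y)"
    using card_image_le[OF fin, of \<alpha>] by (simp add: vec_dim_card card_cart_basis)
  moreover have "walls_at y \<noteq> {0..CARD('n)}"
  proof
    assume "walls_at y = {0..CARD('n)}"
    then have "(\<Sum>j\<in>{0..CARD('n)}. of_int (mark j) * affine_value (simple_affine j) y) = 0"
      by (intro sum.neutral) (auto simp: walls_at_def)
    then show False using sum_marks[of y] by simp
  qed
  then obtain p where p: "p \<in> {0..CARD('n)}" "p \<notin> walls_at y" using sub by blast
  ultimately have "card ({0..CARD('n)} - {p}) \<le> card (walls_at y)" by simp
  moreover have "walls_at y \<subseteq> {0..CARD('n)} - {p}" using sub p by blast
  ultimately have "walls_at y = {0..CARD('n)} - {p}" by (intro card_seteq) auto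
  with p(1) show ?thesis using vertex_unique by blast
qed

text \<open>
  The point with complex conjugate coordinates takes the same integral values, hence equals \<open>x\<close>.
\<close>

lemma spanning_point_is_real:
  assumes "vec.span (point_system \<Phi> (torus_proj \<Phi> x)) = UNIV"
  shows "x \<in> real_points"
proof -
  define x' where "x' = (\<Sum>j\<in>{1..CARD('n)}. cnj (pairing (\<alpha> j) x) *s coweight j)"
  have x': "pairing \<beta> x' = cnj (pairing \<beta> x)" if \<beta>: "\<beta> \<in> \<Phi>" for \<beta>
  proof -
    have "pairing \<beta> x = (\<Sum>j\<in>{1..CARD('n)}. of_int (root_coord \<beta> j) * pairing (\<alpha> j) x)"
      by (subst root_coord_expansion[OF \<beta>]) (simp add: pairing_sum_left pairing_scale_left)
    then have "cnj (pairing \<beta> x) = (\<Sum>j\<in>{1..CARD('n)}. of_int (root_coord \<beta> j) * cnj (pairing (\<alpha> j) x))"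
      by simp
    also have "\<dots> = pairing \<beta> x'"
      unfolding x'_def pairing_sum_right pairing_scale_right
      by (intro sum.cong) (auto simp: root_coord[OF \<beta>])
    finally show ?thesis by simp
  qed
  \<comment> \<open>Integers are their own conjugates.\<close>
  have "x = x'"
  proof (rule eq_if_pairing_eq_on_spanning[OF assms])
    fix \<beta> assume "\<beta> \<in> point_system \<Phi> (torus_proj \<Phi> x)"
    then show "pairing \<beta> x = pairing \<beta> x'"
      by (auto simp: point_system_proj x' elim!: Ints_cases)
  qed
  then have "cnj (pairing \<beta> x) = pairing \<beta> x" if "\<beta> \<in> \<Phi>" for \<beta>
    using x'[OF that] by simp
  then show ?thesis by (simp add: real_points_def Reals_cnj_iff)
qed

text \<open>
  Otherwise one could move the vertex in a direction killed by its roots without leaving its walls.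
\<close>

lemma vertex_spanning:
  assumes p: "p \<in> {0..CARD('n)}"
  shows "vec.span (point_system \<Phi> (torus_proj \<Phi> (vertex p))) = UNIV"
proof (rule ccontr)
  assume "vec.span (point_system \<Phi> (torus_proj \<Phi> (vertex p))) \<noteq> UNIV"
  then obtain u where u: "u \<noteq> 0" "\<forall>\<beta>\<in>point_system \<Phi> (torus_proj \<Phi> (vertex p)). pairing \<beta> u = 0"
    using ex_nonzero_vector_annihilated by blast
  have zero: "pairing (\<alpha> j) u = 0" if "j \<in> {0..CARD('n)}" "j \<noteq> p" for j
  proof -
    have "affine_value (simple_affine j) (vertex p) = 0"
      using affine_value_simple_vertex[OF that(1) p] that(2) by simp
    then have "pairing (\<alpha> j) (vertex p) = of_int (- snd (simple_affine j))"
      by (simp add: affine_value_def add_eq_0_iff2)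
    then have "\<alpha> j \<in> point_system \<Phi> (torus_proj \<Phi> (vertex p))"
      using alpha_root[OF that(1)] by (simp only: point_system_proj mem_Collect_eq Ints_of_int simp_thms)
    with u(2) show ?thesis by blast
  qed
  have "walls_at (u + vertex p) \<supseteq> {0..CARD('n)} - {p}"
  proof
    fix j assume j: "j \<in> {0..CARD('n)} - {p}"
    then have "affine_value (simple_affine j) (u + vertex p) = affine_value (simple_affine j) (vertex p)"
      using zero[of j] by (simp add: affine_value_def pairing_add_right)
    with j p show "j \<in> walls_at (u + vertex p)"
      using affine_value_simple_vertex[of j p] by (simp add: walls_at_def)
  qed
  then have "u + vertex p = vertex p" by (rule vertex_unique[OF p])
  with u(1) show False by simp
qed


section \<open>The subsystem and the stabilizer of a vertex\<close>

text \<open>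
  Subtracting a simple root with positive Cartan integer does not leave the root system and lowers
  the height; so \<open>b\<close> is built up from simple affine roots other than \<open>p\<close> one at a time.
\<close>

lemma in_subsystem_if_pos:
  assumes p: "p \<in> {0..CARD('n)}" and \<Theta>: "subsystem \<Phi> \<Theta>" "\<alpha> ` ({0..CARD('n)} - {p}) \<subseteq> \<Theta>"
    and "b \<in> affine_roots" "positive_affine b" "affine_coord b p = 0"
  shows "fst b \<in> \<Theta>"
  using assms(4-)
proof (induction "nat (\<Sum>j\<in>{0..CARD('n)}. affine_coord b j)" arbitrary: b rule: less_induct)
  case less
  note b = less.prems(1)
  have fst_b: "fst b \<in> \<Phi>" using b by auto
  obtain i where i: "i \<in> {0..CARD('n)}" "affine_coord b i > 0" "cartan_int \<Phi> (fst b) (\<alpha> i) > 0"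
    using ex_simple_with_positive_cartan_int[OF b less.prems(2)] by blast
  have "i \<noteq> p" using i(2) less.prems(3) by auto
  then have ai: "\<alpha> i \<in> \<Theta>" using \<Theta>(2) i(1) by blast
  show ?case
  proof (cases "fst b = \<alpha> i")
    case True
    with ai show ?thesis by simp
  next
    case False
    let ?b = "(fst b - \<alpha> i, snd b - snd (simple_affine i))"
    have diff: "fst b - \<alpha> i \<in> \<Phi>"
      by (rule root_diff[OF fst_b alpha_root[OF i(1)] False i(3)])
    then have b': "?b \<in> affine_roots" by simp
    have coord: "affine_coord ?b j = affine_coord b j - (if i = j then 1 else 0)" if j: "j \<in> {0..CARD('n)}" for j
    proof -
      have "(of_int (affine_coord ?b j) :: complex)
          = of_int (affine_coord b j) - of_int (affine_coord (simple_affine i) j)"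
        unfolding of_int_affine_coord[OF b' j] of_int_affine_coord[OF b j]
          of_int_affine_coord[OF simple_affine_in[OF i(1)] j]
        by (simp add: pairing_diff_left algebra_simps)
      then have "affine_coord ?b j = affine_coord b j - affine_coord (simple_affine i) j"
        by (simp only: of_int_eq_iff flip: of_int_diff)
      then show ?thesis by (simp only: affine_coord_simple[OF i(1) j])
    qed
    have "positive_affine ?b"
      unfolding positive_affine_def
    proof
      fix j assume j: "j \<in> {0..CARD('n)}"
      then have "affine_coord b j \<ge> 0" using less.prems(2) by (simp add: positive_affine_def)
      then show "affine_coord ?b j \<ge> 0" using coord[OF j] i(2) by auto
    qed
    moreover have "affine_coord ?b p = 0"
      using coord[OF p] less.prems(3) \<open>i \<noteq> p\<close> by simp
    moreover have "nat (\<Sum>j\<in>{0..CARD('n)}. affine_coord ?b j) < nat (\<Sum>j\<in>{0..CARD('n)}. affine_coord b j)"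
    proof -
      have "(\<Sum>j\<in>{0..CARD('n)}. affine_coord ?b j)
          = (\<Sum>j\<in>{0..CARD('n)}. affine_coord b j - (if i = j then 1 else 0))"
        by (intro sum.cong refl coord)
      also have "\<dots> = (\<Sum>j\<in>{0..CARD('n)}. affine_coord b j) - 1"
        using i(1) by (simp add: sum_subtractf)
      finally have "(\<Sum>j\<in>{0..CARD('n)}. affine_coord ?b j) < (\<Sum>j\<in>{0..CARD('n)}. affine_coord b j)" by simp
      moreover have "(\<Sum>j\<in>{0..CARD('n)}. affine_coord ?b j) \<ge> 0"
        using \<open>positive_affine ?b\<close> unfolding positive_affine_def by (intro sum_nonneg) blast
      ultimately show ?thesis by simp
    qed
    ultimately have "fst ?b \<in> \<Theta>" using less.hyps b' by blast
    then have "fst b - \<alpha> i \<in> \<Theta>" by simp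
    moreover have "(fst b - \<alpha> i) + \<alpha> i = fst b" by simp
    ultimately show ?thesis using \<Theta>(1) ai fst_b unfolding subsystem_def by metis
  qed
qed

text \<open>
  A root integral at the vertex is the linear part of an affine root vanishing there, which does not
  involve \<open>simple_affine p\<close>.
\<close>

theorem vertex_system_eq:
  assumes p: "p \<in> {0..CARD('n)}"
  shows "vertex_system \<Phi> \<alpha> p = point_system \<Phi> (torus_proj \<Phi> (vertex p))"
proof
  let ?S = "\<alpha> ` ({0..CARD('n)} - {p})"
  have "subsystem \<Phi> (point_system \<Phi> (torus_proj \<Phi> (vertex p)))"
    by (auto simp: subsystem_def point_system_proj minus_root pairing_add_left)
  moreover have "?S \<subseteq> point_system \<Phi> (torus_proj \<Phi> (vertex p))"
  proof
    fix \<beta> assume "\<beta> \<in> ?S"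
    then obtain j where j: "j \<in> {0..CARD('n)}" "j \<noteq> p" "\<beta> = \<alpha> j" by blast
    have "affine_value (simple_affine j) (vertex p) = 0"
      using affine_value_simple_vertex[OF j(1) p] j(2) by simp
    then have "pairing \<beta> (vertex p) = of_int (- snd (simple_affine j))"
      by (simp add: affine_value_def add_eq_0_iff2 j(3))
    then have "pairing \<beta> (vertex p) \<in> \<int>" by (simp only: Ints_of_int)
    then show "\<beta> \<in> point_system \<Phi> (torus_proj \<Phi> (vertex p))"
      using alpha_root[OF j(1)] by (simp add: point_system_proj j(3))
  qed
  ultimately show "vertex_system \<Phi> \<alpha> p \<subseteq> point_system \<Phi> (torus_proj \<Phi> (vertex p))"
    unfolding vertex_system_def by (intro hull_minimal)
  show "point_system \<Phi> (torus_proj \<Phi> (vertex p)) \<subseteq> vertex_system \<Phi> \<alpha> p"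
  proof
    fix \<beta> assume "\<beta> \<in> point_system \<Phi> (torus_proj \<Phi> (vertex p))"
    then obtain k where \<beta>: "\<beta> \<in> \<Phi>" and k: "pairing \<beta> (vertex p) = of_int k"
      by (auto simp: point_system_proj elim: Ints_cases)
    let ?b = "(\<beta>, - k)"
    have b: "?b \<in> affine_roots" "(- \<beta>, k) \<in> affine_roots" using \<beta> minus_root by simp_all
    have "affine_value ?b (vertex p) = 0" by (simp add: affine_value_def k)
    then have zero: "affine_coord ?b p = 0"
      using affine_value_vertex[OF b(1) p] mark_pos[OF p] by simp
    have "\<beta> \<in> \<Theta>" if \<Theta>: "subsystem \<Phi> \<Theta>" "?S \<subseteq> \<Theta>" for \<Theta>
    proof (cases "positive_affine ?b")
      case True
      then show ?thesis using in_subsystem_if_pos[OF p \<Theta> b(1)] zero by simp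
    next
      case False
      have opp: "affine_coord (- \<beta>, k) j = - affine_coord ?b j" if "j \<in> {0..CARD('n)}" for j
        using affine_coord_opposite[OF b(1) that] by simp
      have "\<forall>j\<in>{0..CARD('n)}. affine_coord ?b j \<le> 0"
        using affine_coord_sign[OF b(1)] False by blast
      then have "positive_affine (- \<beta>, k)"
        unfolding positive_affine_def using opp by auto
      then have "- \<beta> \<in> \<Theta>"
        using in_subsystem_if_pos[OF p \<Theta> b(2)] opp[OF p] zero by simp
      then have "- (- \<beta>) \<in> \<Theta>" using \<Theta>(1) unfolding subsystem_def by blast
      then show ?thesis by simp
    qed
    then show "\<beta> \<in> vertex_system \<Phi> \<alpha> p"
      unfolding vertex_system_def hull_def by blast
  qed
qed

lemma vertex_group_eq:
  assumes "p \<in> {0..CARD('n)}"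
  shows "vertex_group \<Phi> \<alpha> p = reflection_product \<Phi> ` {l. set l \<subseteq> \<alpha> ` ({0..CARD('n)} - {p})}"
  unfolding vertex_group_def
  by (rule generate_weyl_group) (use alpha_root in auto)

text \<open>
  An element of \<open>W\<close> that fixes the point of the torus fixes the vertex after composition with a
  translation.  By \<open>alcove_stabilizer\<close> it is then a word in the walls through the vertex, and the
  linear parts of these are the generators of the vertex group.
\<close>

theorem stabilizer_vertex:
  assumes p: "p \<in> {0..CARD('n)}"
  shows "stabilizer (weyl_group \<Phi>) torus_act (torus_proj \<Phi> (vertex p)) = vertex_group \<Phi> \<alpha> p"
proof (intro equalityI subsetI)
  fix g assume "g \<in> stabilizer (weyl_group \<Phi>) torus_act (torus_proj \<Phi> (vertex p))"
  then obtain l where l: "g = reflection_product \<Phi> l" "set l \<subseteq> \<Phi>"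
    and "torus_act g (torus_proj \<Phi> (vertex p)) = torus_proj \<Phi> (vertex p)"
    by (auto simp: stabilizer_def carrier_weyl_group)
  then have q: "vertex p - reflection_product \<Phi> l (vertex p) \<in> coroot_lattice \<Phi>" (is "?q \<in> _")
    using torus_act_proj[OF l(2)] torus_proj_eq_iff by metis
  obtain w where w: "set w \<subseteq> {0..CARD('n)}" "\<forall>x. reflection_product \<Phi> l x + ?q = word_act w x"
    using affine_weyl_element_is_word[OF l(2) q] by blast
  have "word_act w (vertex p) = vertex p" using w(2)[rule_format, of "vertex p"] by simp
  then obtain v where v: "set v \<subseteq> walls_at (vertex p)" "\<forall>x. word_act w x = word_act v x"
    using alcove_stabilizer[OF w(1) vertex_in_alcove[OF p]] vertex_in_alcove[OF p] by auto
  then have v': "set v \<subseteq> {0..CARD('n)} - {p}" by (simp add: walls_at_vertex[OF p])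
  then have "set v \<subseteq> {0..CARD('n)}" by blast
  then obtain q' where q': "\<forall>x. word_act v x = reflection_product \<Phi> (map \<alpha> v) x + q'"
    using word_act_linear_part by blast
  have eq: "reflection_product \<Phi> l x + ?q = reflection_product \<Phi> (map \<alpha> v) x + q'" for x
    using w(2) v(2) q' by simp
  from eq[of 0] have "?q = q'" by (simp add: reflection_product_linear)
  with eq have "g = reflection_product \<Phi> (map \<alpha> v)" by (simp add: fun_eq_iff l(1))
  then show "g \<in> vertex_group \<Phi> \<alpha> p"
    unfolding vertex_group_eq[OF p] by (intro image_eqI[of _ _ "map \<alpha> v"]) (use v' in auto)
next
  fix g assume "g \<in> vertex_group \<Phi> \<alpha> p"
  then obtain l where l: "g = reflection_product \<Phi> l" "set l \<subseteq> \<alpha> ` ({0..CARD('n)} - {p})"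
    unfolding vertex_group_eq[OF p] by blast
  from l(2) have "l \<in> lists (\<alpha> ` ({0..CARD('n)} - {p}))" by (simp add: in_lists_conv_set subset_iff)
  then obtain v where v: "l = map \<alpha> v" "set v \<subseteq> {0..CARD('n)} - {p}"
    unfolding lists_image by (auto simp: lists_eq_set)
  have l\<Phi>: "set l \<subseteq> \<Phi>" using l(2) alpha_root by auto
  have "set v \<subseteq> {0..CARD('n)}" using v by blast
  then obtain q where q: "q \<in> coroot_lattice \<Phi>" "\<forall>x. word_act v x = reflection_product \<Phi> l x + q"
    using word_act_linear_part v(1) by blast
  have "word_act v (vertex p) = vertex p"
    by (rule word_act_fixes) (simp add: walls_at_vertex[OF p] v(2))
  then have "vertex p - reflection_product \<Phi> l (vertex p) \<in> coroot_lattice \<Phi>"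
    using q by (metis add_diff_cancel_left')
  then have "torus_act g (torus_proj \<Phi> (vertex p)) = torus_proj \<Phi> (vertex p)"
    by (metis l(1) torus_act_proj[OF l\<Phi>] torus_proj_eq_iff)
  then show "g \<in> stabilizer (weyl_group \<Phi>) torus_act (torus_proj \<Phi> (vertex p))"
    using l\<Phi> by (auto simp: stabilizer_def carrier_weyl_group l(1))
qed


section \<open>Orbits of zero-dimensional layers\<close>

lemma torus_act_append:
  "torus_act (reflection_product \<Phi> (k @ l)) t = torus_act (reflection_product \<Phi> k) (torus_act (reflection_product \<Phi> l) t)"
  by (auto simp: torus_act_def image_image reflection_product_append)

lemma torus_act_rev_cancel:
  assumes "set l \<subseteq> \<Phi>"
  shows "torus_act (reflection_product \<Phi> (rev l)) (torus_act (reflection_product \<Phi> l) t) = t"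
    and "torus_act (reflection_product \<Phi> l) (torus_act (reflection_product \<Phi> (rev l)) t) = t"
  by (simp_all add: torus_act_def image_image reflection_product_rev_cancel[OF assms])

lemma orbit_torus: "orbit (weyl_group \<Phi>) torus_act t = {torus_act (reflection_product \<Phi> l) t | l. set l \<subseteq> \<Phi>}"
  by (auto simp: orbit_def carrier_weyl_group)

lemma orbit_torus_act:
  assumes "set l \<subseteq> \<Phi>"
  shows "orbit (weyl_group \<Phi>) torus_act (torus_act (reflection_product \<Phi> l) t) = orbit (weyl_group \<Phi>) torus_act t"
proof -
  have "\<exists>m. torus_act (reflection_product \<Phi> k) t = torus_act (reflection_product \<Phi> m) (torus_act (reflection_product \<Phi> l) t) \<and> set m \<subseteq> \<Phi>"
    if "set k \<subseteq> \<Phi>" for k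
    by (rule exI[of _ "k @ rev l"]) (use assms that in \<open>simp add: torus_act_append torus_act_rev_cancel\<close>)
  moreover have "\<exists>m. torus_act (reflection_product \<Phi> k) (torus_act (reflection_product \<Phi> l) t) = torus_act (reflection_product \<Phi> m) t \<and> set m \<subseteq> \<Phi>"
    if "set k \<subseteq> \<Phi>" for k
    by (rule exI[of _ "k @ l"]) (use assms that in \<open>simp add: torus_act_append\<close>)
  ultimately show ?thesis unfolding orbit_torus by blast
qed

text \<open>
  Move a representative into the alcove by the affine Weyl group.  The roots integral at the
  image are the transformed ones, hence still span.
\<close>

lemma spanning_point_equivalent_to_vertex:
  assumes "t \<in> zero_dim_layers \<Phi> \<alpha>"
  shows "\<exists>p\<in>{0..CARD('n)}. \<exists>l. set l \<subseteq> \<Phi> \<and> torus_act (reflection_product \<Phi> l) t = torus_proj \<Phi> (vertex p)"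
proof -
  from assms obtain x where t: "t = torus_proj \<Phi> x" and span: "vec.span (point_system \<Phi> (torus_proj \<Phi> x)) = UNIV"
    by (auto simp: zero_dim_layers_eq torus_eq)
  obtain w where w: "set w \<subseteq> {0..CARD('n)}" "word_act w x \<in> alcove"
    using ex_word_into_alcove[OF spanning_point_is_real[OF span]] by blast
  let ?l = "map \<alpha> w" and ?y = "word_act w x"
  have l: "set ?l \<subseteq> \<Phi>" using w(1) alpha_root by auto
  obtain q where q: "q \<in> coroot_lattice \<Phi>" "\<forall>x. word_act w x = reflection_product \<Phi> ?l x + q"
    using word_act_linear_part[OF w(1)] by blast
  have act: "torus_act (reflection_product \<Phi> ?l) t = torus_proj \<Phi> ?y"
    unfolding t torus_act_proj[OF l] torus_proj_eq_iff using q minus_in_lattice by simp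
  have "vec.span (point_system \<Phi> (torus_proj \<Phi> ?y)) = UNIV"
  proof (rule ccontr)
    assume "vec.span (point_system \<Phi> (torus_proj \<Phi> ?y)) \<noteq> UNIV"
    then obtain u where u: "u \<noteq> 0" "\<forall>\<beta>\<in>point_system \<Phi> (torus_proj \<Phi> ?y). pairing \<beta> u = 0"
      using ex_nonzero_vector_annihilated by blast
    have "pairing \<beta> (reflection_product \<Phi> (rev ?l) u) = pairing \<beta> 0"
      if "\<beta> \<in> point_system \<Phi> (torus_proj \<Phi> x)" for \<beta>
    proof -
      have "torus_proj \<Phi> x \<in> torus \<Phi>" by (simp add: torus_eq)
      from point_system_torus_act[OF l this] that
      have "dual_act (reflection_product \<Phi> ?l) \<beta> \<in> point_system \<Phi> (torus_proj \<Phi> ?y)"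
        using act by (simp add: t)
      with u(2) have "pairing (dual_act (reflection_product \<Phi> ?l) \<beta>) u = 0" by blast
      then show ?thesis by (simp only: pairing_dual_act[OF l] pairing_zero_right)
    qed
    then have "reflection_product \<Phi> (rev ?l) u = 0" by (rule eq_if_pairing_eq_on_spanning[OF span])
    then have "u = 0" using reflection_product_rev_cancel(1)[OF l, of u] by (simp add: reflection_product_linear)
    with u(1) show False ..
  qed
  from spanning_point_is_vertex[OF w(2) this] obtain p where p: "p \<in> {0..CARD('n)}" and y: "?y = vertex p" by blast
  show ?thesis by (rule bexI[OF _ p], rule exI[of _ ?l], rule conjI[OF l act[unfolded y]])
qed

lemma vertex_orbits_distinct:
  assumes p: "p \<in> {0..CARD('n)}" and p': "p' \<in> {0..CARD('n)}" and l: "set l \<subseteq> \<Phi>"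
    and eq: "torus_act (reflection_product \<Phi> l) (torus_proj \<Phi> (vertex p)) = torus_proj \<Phi> (vertex p')"
  shows "p = p'"
proof -
  have q: "vertex p' - reflection_product \<Phi> l (vertex p) \<in> coroot_lattice \<Phi>"
    using eq torus_act_proj[OF l] torus_proj_eq_iff by metis
  from affine_weyl_element_is_word[OF l q] obtain w where w: "set w \<subseteq> {0..CARD('n)}"
    "\<forall>x. reflection_product \<Phi> l x + (vertex p' - reflection_product \<Phi> l (vertex p)) = word_act w x" by blast
  have wp: "word_act w (vertex p) = vertex p'" using w(2)[rule_format, of "vertex p"] by simp
  then obtain v where "set v \<subseteq> walls_at (vertex p)" "\<forall>x. word_act w x = word_act v x"
    using alcove_stabilizer[OF w(1) vertex_in_alcove[OF p]] vertex_in_alcove[OF p'] by auto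
  then have "vertex p' = vertex p" using word_act_fixes wp by simp
  then have "{0..CARD('n)} - {p'} = {0..CARD('n)} - {p}"
    using walls_at_vertex p p' by metis
  with p p' show ?thesis by blast
qed

lemma stabilizer_torus_act:
  assumes l: "set l \<subseteq> \<Phi>"
  shows "stabilizer (weyl_group \<Phi>) torus_act (torus_act (reflection_product \<Phi> l) t)
    = reflection_product \<Phi> l <#\<^bsub>weyl_group \<Phi>\<^esub> stabilizer (weyl_group \<Phi>) torus_act t
        #>\<^bsub>weyl_group \<Phi>\<^esub> m_inv (weyl_group \<Phi>) (reflection_product \<Phi> l)" (is "?A = ?B")
proof -
  let ?S = "stabilizer (weyl_group \<Phi>) torus_act"
  have conj: "?B = {reflection_product \<Phi> (l @ k @ rev l) | k. set k \<subseteq> \<Phi> \<and> torus_act (reflection_product \<Phi> k) t = t}"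
  proof -
    have mult: "reflection_product \<Phi> l \<otimes>\<^bsub>weyl_group \<Phi>\<^esub> reflection_product \<Phi> k \<otimes>\<^bsub>weyl_group \<Phi>\<^esub>
        reflection_product \<Phi> (rev l) = reflection_product \<Phi> (l @ k @ rev l)" if "set k \<subseteq> \<Phi>" for k
      using l that by (simp add: weyl_group_mult)
    have S: "?S t = {reflection_product \<Phi> k | k. set k \<subseteq> \<Phi> \<and> torus_act (reflection_product \<Phi> k) t = t}"
      by (auto simp: stabilizer_def carrier_weyl_group)
    show ?thesis
      unfolding weyl_group_inv[OF l] S l_coset_def r_coset_def by (auto simp: mult; metis mult)
  qed
  have fix_iff: "torus_act (reflection_product \<Phi> k) (torus_act (reflection_product \<Phi> l) t) = torus_act (reflection_product \<Phi> l) t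
      \<longleftrightarrow> torus_act (reflection_product \<Phi> (rev l @ k @ l)) t = t" for k
    unfolding torus_act_append using torus_act_rev_cancel[OF l] by metis
  show ?thesis
  proof (intro equalityI subsetI)
    fix g assume "g \<in> ?A"
    then obtain k where k: "g = reflection_product \<Phi> k" "set k \<subseteq> \<Phi>"
      "torus_act (reflection_product \<Phi> (rev l @ k @ l)) t = t"
      using fix_iff by (auto simp: stabilizer_def carrier_weyl_group)
    have "g = reflection_product \<Phi> (l @ (rev l @ k @ l) @ rev l)"
      by (simp add: k(1) fun_eq_iff reflection_product_append reflection_product_rev_cancel[OF l])
    moreover have "set (rev l @ k @ l) \<subseteq> \<Phi>" using k(2) l by simp
    ultimately show "g \<in> ?B" unfolding conj using k(3) by blast
  next
    fix g assume "g \<in> ?B"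
    then obtain k where k: "g = reflection_product \<Phi> (l @ k @ rev l)" "set k \<subseteq> \<Phi>"
      "torus_act (reflection_product \<Phi> k) t = t"
      unfolding conj by blast
    have "torus_act g (torus_act (reflection_product \<Phi> l) t) = torus_act (reflection_product \<Phi> l) t"
      unfolding k(1) torus_act_append by (simp add: torus_act_rev_cancel[OF l] k(3))
    moreover have "g \<in> carrier (weyl_group \<Phi>)"
      unfolding carrier_weyl_group k(1) by (rule imageI) (use k(2) l in simp)
    ultimately show "g \<in> ?A" by (simp add: stabilizer_def)
  qed
qed

text \<open>
  The alcove contains a representative of every orbit, and it is a vertex; different vertices are
  inequivalent by \<open>alcove_stabilizer\<close>.
\<close>

theorem orbits_of_zero_dim_layers:
  "bij_betw (\<lambda>p. orbit (weyl_group \<Phi>) torus_act (torus_proj \<Phi> (vertex p))) {0..CARD('n)}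
     (orbits (weyl_group \<Phi>) (zero_dim_layers \<Phi> \<alpha>) torus_act)"
  unfolding bij_betw_def
proof
  let ?O = "orbit (weyl_group \<Phi>) torus_act"
  show "inj_on (\<lambda>p. ?O (torus_proj \<Phi> (vertex p))) {0..CARD('n)}"
  proof (rule inj_onI)
    fix p p' assume p: "p \<in> {0..CARD('n)}" "p' \<in> {0..CARD('n)}"
      and eq: "?O (torus_proj \<Phi> (vertex p)) = ?O (torus_proj \<Phi> (vertex p'))"
    have "torus_proj \<Phi> (vertex p') \<in> ?O (torus_proj \<Phi> (vertex p'))"
      unfolding orbit_torus by (intro CollectI exI[of _ "[]"]) (simp add: torus_act_def)
    then have "torus_proj \<Phi> (vertex p') \<in> ?O (torus_proj \<Phi> (vertex p))" by (simp only: eq)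
    then obtain l where "set l \<subseteq> \<Phi>"
      "torus_act (reflection_product \<Phi> l) (torus_proj \<Phi> (vertex p)) = torus_proj \<Phi> (vertex p')"
      unfolding orbit_torus by auto
    then show "p = p'" using vertex_orbits_distinct p by blast
  qed
  have "torus_proj \<Phi> (vertex p) \<in> zero_dim_layers \<Phi> \<alpha>" if "p \<in> {0..CARD('n)}" for p
    using vertex_spanning[OF that] by (simp add: zero_dim_layers_eq torus_eq)
  moreover have "\<exists>p\<in>{0..CARD('n)}. ?O t = ?O (torus_proj \<Phi> (vertex p))" if "t \<in> zero_dim_layers \<Phi> \<alpha>" for t
    using spanning_point_equivalent_to_vertex[OF that] orbit_torus_act by metis
  ultimately show "(\<lambda>p. ?O (torus_proj \<Phi> (vertex p))) ` {0..CARD('n)}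
      = orbits (weyl_group \<Phi>) (zero_dim_layers \<Phi> \<alpha>) torus_act"
    unfolding orbits_def image_def by (intro equalityI subsetI CollectI; elim CollectE bexE exE conjE; metis)
qed

end

theorem theorem1:
  fixes \<Phi> :: "(complex^'n) set" and \<alpha> :: "nat \<Rightarrow> complex^'n"
  assumes "root_system \<Phi>" and "irreducible_system \<Phi>"
    and "simple_roots \<Phi> \<alpha>"
    and "is_highest_root \<Phi> \<alpha> (- \<alpha> 0)"
  shows "\<exists>\<O> :: nat \<Rightarrow> (complex^'n) set set.
           bij_betw \<O> {0..CARD('n)} (orbits (weyl_group \<Phi>) (zero_dim_layers \<Phi> \<alpha>) torus_act) \<and>
           (\<forall>p\<in>{0..CARD('n)}. \<forall>t\<in>\<O> p.
              (\<exists>w\<in>carrier (weyl_group \<Phi>).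
                 point_system \<Phi> t = dual_act w ` vertex_system \<Phi> \<alpha> p) \<and>
              (\<exists>w\<in>carrier (weyl_group \<Phi>).
                 stabilizer (weyl_group \<Phi>) torus_act t =
                   w <#\<^bsub>weyl_group \<Phi>\<^esub> vertex_group \<Phi> \<alpha> p #>\<^bsub>weyl_group \<Phi>\<^esub> (m_inv (weyl_group \<Phi>) w)))"
proof -
  interpret based_root_sys \<Phi> \<alpha>
    by unfold_locales (use assms in auto)
  let ?O = "\<lambda>p. orbit (weyl_group \<Phi>) torus_act (torus_proj \<Phi> (vertex p))"
  have "(\<exists>w\<in>carrier (weyl_group \<Phi>). point_system \<Phi> t = dual_act w ` vertex_system \<Phi> \<alpha> p) \<and>
      (\<exists>w\<in>carrier (weyl_group \<Phi>). stabilizer (weyl_group \<Phi>) torus_act t =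
         w <#\<^bsub>weyl_group \<Phi>\<^esub> vertex_group \<Phi> \<alpha> p #>\<^bsub>weyl_group \<Phi>\<^esub> (m_inv (weyl_group \<Phi>) w))"
    if p: "p \<in> {0..CARD('n)}" and t: "t \<in> ?O p" for p t
  proof -
    obtain l where l: "set l \<subseteq> \<Phi>" and tl: "t = torus_act (reflection_product \<Phi> l) (torus_proj \<Phi> (vertex p))"
      using t unfolding orbit_torus by blast
    have w: "reflection_product \<Phi> l \<in> carrier (weyl_group \<Phi>)"
      unfolding carrier_weyl_group using l by blast
    have "torus_proj \<Phi> (vertex p) \<in> torus \<Phi>" by (simp add: torus_eq)
    from point_system_torus_act[OF l this]
    have "point_system \<Phi> t = dual_act (reflection_product \<Phi> l) ` vertex_system \<Phi> \<alpha> p"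
      unfolding tl vertex_system_eq[OF p] .
    moreover have "stabilizer (weyl_group \<Phi>) torus_act t =
        reflection_product \<Phi> l <#\<^bsub>weyl_group \<Phi>\<^esub> vertex_group \<Phi> \<alpha> p #>\<^bsub>weyl_group \<Phi>\<^esub>
          (m_inv (weyl_group \<Phi>) (reflection_product \<Phi> l))"
      using stabilizer_torus_act[OF l] unfolding tl stabilizer_vertex[OF p, symmetric] .
    ultimately show ?thesis using w by blast
  qed
  then show ?thesis
    by (intro exI[of _ ?O] conjI ballI orbits_of_zero_dim_layers) blast+
qed

end
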